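(* Let $(a_{nk})_{n\ge0,k\in\mathbb Z}$ be complex scalars with $\sum_{k\in\mathbb Z}|a_{nk}|<\infty$ for each $n\ge0$. Then the following are equivalent: (i) $\sum_{k\in\mathbb Z}a_{nk}\hat f(k)e^{ikt}\to f$ weakly in $C(\mathbb T)$, for all $f\in C(\mathbb T)$; (ii) $\sum_{k\in\mathbb Z}a_{nk}\hat f(k)e^{ikt}\to f$ in sup-norm, for all $f\in C(\mathbb T)$; (iii) $\sum_{k\in\mathbb Z}a_{nk}\hat\mu(k)e^{ikt}\,dt/2\pi\to\mu$ weak* in $M(\mathbb T)$, for all $\mu\in M(\mathbb T)$; (iv) $\sum_{k\in\mathbb Z}a_{nk}\hat g(k)e^{ikt}\,dt/2\pi\to g(e^{it})\,dt/2\pi$ weak* in $M(\mathbb T)$, for all $g\in L^1(\mathbb T)$; (v) $\sum_{k\in\mathbb Z}a_{nk}\hat g(k)e^{ikt}\to g$ in $L^1(\mathbb T)$-norm, for all $g\in L^1(\mathbb T)$.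
   Context: $\mathbb T$ is the unit circle, $C(\mathbb T)$ the continuous complex functions with sup-norm, $M(\mathbb T)$ the finite complex Borel measures with total-variation norm, identified with $C(\mathbb T)^*$ via $\langle f,\mu\rangle=\int_{\mathbb T}f(\zeta)\,d\mu(\overline\zeta)$; weak* refers to this duality. $L^1(\mathbb T)$ is identified with absolutely continuous measures via $g\leftrightarrow g(e^{it})dt/2\pi$. Fourier coefficients: $\hat\mu(k)=\int_{\mathbb T}\overline\zeta^k\,d\mu(\zeta)$, $\hat f(k)=\frac1{2\pi}\int_0^{2\pi}f(e^{it})e^{-ikt}dt$. *)

theory Defs
  imports "HOL-Analysis.Analysis"
begin

definition circle :: "complex set" where
  "circle = sphere 0 1"

definition fourier_coeff :: "(complex \<Rightarrow> complex) \<Rightarrow> int \<Rightarrow> complex" where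
  "fourier_coeff f k =
     complex_of_real (1 / (2 * pi)) *
       (LINT t:{0..2*pi}|lborel. f (cis t) * cis (- (of_int k * t)))"

definition mult_series ::
    "(nat \<Rightarrow> int \<Rightarrow> complex) \<Rightarrow> nat \<Rightarrow> (int \<Rightarrow> complex) \<Rightarrow> complex \<Rightarrow> complex" where
  "mult_series a n c z = (\<Sum>\<^sub>\<infinity>k. a n k * c k * z powi k)"

text \<open>Bounded linear functionals on C(T) (acting on functions complex => complex,
  only their values on T for continuous arguments matter).\<close>
definition CT_dual :: "((complex \<Rightarrow> complex) \<Rightarrow> complex) \<Rightarrow> bool" where
  "CT_dual \<phi> \<longleftrightarrow>
     (\<forall>f g. continuous_on circle f \<longrightarrow> continuous_on circle g \<longrightarrow>
        \<phi> (\<lambda>z. f z + g z) = \<phi> f + \<phi> g) \<and>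
     (\<forall>c f. continuous_on circle f \<longrightarrow> \<phi> (\<lambda>z. c * f z) = c * \<phi> f) \<and>
     (\<forall>f g. continuous_on circle f \<longrightarrow> continuous_on circle g \<longrightarrow>
        (\<forall>z\<in>circle. f z = g z) \<longrightarrow> \<phi> f = \<phi> g) \<and>
     (\<exists>C. \<forall>f B. continuous_on circle f \<longrightarrow> (\<forall>z\<in>circle. norm (f z) \<le> B) \<longrightarrow>
        norm (\<phi> f) \<le> C * B)"

definition fin_borel_T :: "complex measure \<Rightarrow> bool" where
  "fin_borel_T M \<longleftrightarrow> sets M = sets (restrict_space borel circle) \<and> finite_measure M"

text \<open>A finite complex Borel measure on T is represented (via Jordan decomposition)
  by a quadruple (M1,M2,M3,M4) of finite positive Borel measures, standing for
  M1 - M2 + i (M3 - M4). Every complex measure arises this way.\<close>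
type_synonym cmeas = "complex measure \<times> complex measure \<times> complex measure \<times> complex measure"

definition cmeasure_T :: "cmeas \<Rightarrow> bool" where
  "cmeasure_T \<mu> = (case \<mu> of (M1, M2, M3, M4) \<Rightarrow>
      fin_borel_T M1 \<and> fin_borel_T M2 \<and> fin_borel_T M3 \<and> fin_borel_T M4)"

definition cint :: "cmeas \<Rightarrow> (complex \<Rightarrow> complex) \<Rightarrow> complex" where
  "cint \<mu> f = (case \<mu> of (M1, M2, M3, M4) \<Rightarrow>
      ((\<integral>z. f z \<partial>M1) - (\<integral>z. f z \<partial>M2)) + \<i> * ((\<integral>z. f z \<partial>M3) - (\<integral>z. f z \<partial>M4)))"

definition meas_coeff :: "cmeas \<Rightarrow> int \<Rightarrow> complex" where
  "meas_coeff \<mu> k = cint \<mu> (\<lambda>z. cnj z powi k)"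

definition pair_meas :: "(complex \<Rightarrow> complex) \<Rightarrow> cmeas \<Rightarrow> complex" where
  "pair_meas f \<mu> = cint \<mu> (\<lambda>z. f (cnj z))"

text \<open>Pairing <f, g(e^(it)) dt/2pi> for an absolutely continuous measure with density g.\<close>
definition pair_L1 :: "(complex \<Rightarrow> complex) \<Rightarrow> (complex \<Rightarrow> complex) \<Rightarrow> complex" where
  "pair_L1 f g = complex_of_real (1 / (2 * pi)) *
      (LINT t:{0..2*pi}|lborel. f (cnj (cis t)) * g (cis t))"

definition L1_T :: "(complex \<Rightarrow> complex) \<Rightarrow> bool" where
  "L1_T g \<longleftrightarrow> set_integrable lborel {0..2*pi} (\<lambda>t. g (cis t))"

definition L1_norm :: "(complex \<Rightarrow> complex) \<Rightarrow> real" where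
  "L1_norm g = (1 / (2 * pi)) * (LINT t:{0..2*pi}|lborel. norm (g (cis t)))"

end

theory Submission
  imports Defs
begin

text \<open>
  Write \<open>T\<^sub>n\<close> for the multiplier operator with symbol \<open>a\<^sub>n\<^sub>k\<close>. The pairing makes \<open>T\<^sub>n\<close> self-adjoint,
  \<open>\<langle>f, T\<^sub>n \<nu>\<rangle> = \<langle>T\<^sub>n f, \<nu>\<rangle>\<close> for functions and measures \<open>\<nu>\<close>, so uniform convergence on C(T)
  yields every weak statement. Conversely, each weak statement shows \<open>a\<^sub>n\<^sub>k \<rightarrow> 1\<close> and makes the
  functionals \<open>f \<mapsto> T\<^sub>n f (1)\<close> pointwise bounded: in (i) by the point evaluation at 1, in (iii)
  by the Dirac measure at 1, and in (iv) by a first application of uniform boundedness on L1.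
  Uniform boundedness on C(T) and rotation invariance then bound \<open>T\<^sub>n\<close> uniformly on C(T), hence by
  duality on L1, and density of trigonometric polynomials (of continuous functions, for L1) gives
  norm convergence.
\<close>

section \<open>Uniform boundedness\<close>

text \<open>The pairing of f with a measure is their convolution evaluated at 1. In it a character
  pairs with itself and not with its conjugate, which is why the transpose of T_n keeps its symbol,
  neither reflected nor conjugated. The obstacle is (iv): the point mass at 1 is not in L1, so the
  values T_n f (1) are not directly accessible to L1 test functions. What L1 does see is the sup
  norm of T_n f, as the norm of a functional on L1, and this yields boundedness of T_n f (1) without
  yielding its convergence. For this reason norm convergence is derived from bounded values at 1
  together with the limits of the coefficients, a hypothesis that every one of the five statements
  can reach.\<close>

text \<open>
  Sokal's gliding hump: one of the two signs in \<open>X\<^sub>j \<plusminus> 3\<^sup>-\<^sup>j \<eta>\<^sub>j\<close> keeps the functional large, and the remaining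
  steps cannot undo it. Completeness is asked only for such geometric series, so that \<open>N\<close> may be a
  seminorm on plain functions, with no quotient type for L1.
\<close>

lemma uniform_boundedness:
  fixes S :: "('b \<Rightarrow> complex) set" and N :: "('b \<Rightarrow> complex) \<Rightarrow> real"
    and T :: "nat \<Rightarrow> ('b \<Rightarrow> complex) \<Rightarrow> complex"
  assumes zero: "(\<lambda>_. 0) \<in> S"
    and comb: "\<And>f g c. f \<in> S \<Longrightarrow> g \<in> S \<Longrightarrow> (\<lambda>x. f x + c * g x) \<in> S"
    and N_nonneg: "\<And>f. f \<in> S \<Longrightarrow> 0 \<le> N f"
    and N_scale: "\<And>f c. f \<in> S \<Longrightarrow> N (\<lambda>x. c * f x) = norm c * N f"
    and T_lin: "\<And>n f g c. f \<in> S \<Longrightarrow> g \<in> S \<Longrightarrow> T n (\<lambda>x. f x + c * g x) = T n f + c * T n g"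
    and T_bdd: "\<And>n f. f \<in> S \<Longrightarrow> norm (T n f) \<le> B n * N f"
    and complete: "\<And>\<xi>. (\<And>j::nat. \<xi> j \<in> S \<and> N (\<xi> j) \<le> (1/3)^j) \<Longrightarrow>
        \<exists>x\<in>S. \<forall>m. N (\<lambda>t. x t - (\<Sum>j<m. \<xi> j t)) \<le> (1/3)^m * (3/2)"
    and pointwise: "\<And>f. f \<in> S \<Longrightarrow> \<exists>M. \<forall>n. norm (T n f) \<le> M"
  shows "\<exists>C\<ge>0. \<forall>n. \<forall>f\<in>S. norm (T n f) \<le> C * N f"
proof -
  define U where "U = {f\<in>S. N f \<le> 1}"
  define D where "D n = (SUP f\<in>U. norm (T n f))" for n
  have zeroN: "N (\<lambda>_. 0) = 0"
    using N_scale[OF zero, of 0] by simp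
  have zU: "(\<lambda>_. 0) \<in> U" using zero zeroN by (simp add: U_def)
  have smult: "(\<lambda>x. c * f x) \<in> S" if "f \<in> S" for f c
    using comb[OF zero that, of c] by simp
  have T0: "T n (\<lambda>_. 0) = 0" for n
    using T_bdd[OF zero, of n] zeroN by simp
  have T_scale: "T n (\<lambda>x. c * f x) = c * T n f" if "f \<in> S" for n f c
    using T_lin[OF zero that, of n c] T0 by simp
  have bdd: "bdd_above ((\<lambda>f. norm (T n f)) ` U)" for n
  proof (rule bdd_aboveI2)
    fix f assume f: "f \<in> U"
    have "norm (T n f) \<le> B n * N f" using T_bdd f by (auto simp: U_def)
    also have "\<dots> \<le> \<bar>B n\<bar> * 1" using f N_nonneg by (intro mult_mono) (auto simp: U_def)
    finally show "norm (T n f) \<le> \<bar>B n\<bar>" by simp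
  qed
  have D_up: "norm (T n f) \<le> D n" if "f \<in> U" for n f
    unfolding D_def using bdd that by (rule cSUP_upper2) auto
  have D_nonneg: "0 \<le> D n" for n using D_up[OF zU, of n] T0 by simp
  have D_bound: "norm (T n f) \<le> D n * N f" if f: "f \<in> S" for n f
  proof (cases "N f = 0")
    \<comment> \<open>\<open>N\<close> is only a seminorm, so a function of seminorm 0 cannot be
      normalised; there \<open>T_bdd\<close> gives the value 0 directly.\<close>
    case True
    then show ?thesis using T_bdd[OF f, of n] by simp
  next
    case False
    then have pos: "N f > 0" using N_nonneg[OF f] by simp
    have "(\<lambda>x. of_real (1 / N f) * f x) \<in> U"
      using smult[OF f, of "of_real (1 / N f)"] N_scale[OF f, of "of_real (1 / N f)"] pos
      by (simp add: U_def norm_divide del: of_real_divide)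
    from D_up[OF this, of n] have "norm (T n f) / N f \<le> D n"
      using T_scale[OF f, of n "of_real (1 / N f)"] pos by (simp add: norm_mult norm_divide)
    then show ?thesis using pos by (simp add: field_simps)
  qed
  show ?thesis
  proof (rule ccontr)
    assume contra: "\<not> ?thesis"
    \<comment> \<open>The growth 4^j beats the step sizes 3^-j used below. The factor 2/3 lies below
      1, so the supremum \<open>D n\<close> is approached that well, and above 1/2, the share that
      the later steps can take away.\<close>
    have "\<exists>n f. f \<in> U \<and> D n > 4 ^ j \<and> norm (T n f) \<ge> 2/3 * D n" for j :: nat
    proof -
      have "\<exists>n. D n > 4 ^ j"
      proof (rule ccontr)
        assume "\<not> (\<exists>n. D n > 4 ^ j)"
        then have "\<And>n. D n \<le> 4 ^ j" by (simp add: not_less)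
        then have "\<forall>n. \<forall>f\<in>S. norm (T n f) \<le> 4 ^ j * N f"
          using D_bound N_nonneg by (meson mult_right_mono order_trans)
        then show False using contra by (metis zero_le_numeral zero_le_power)
      qed
      then obtain n where n: "D n > 4 ^ j" ..
      have "2/3 * D n < D n" using less_trans[OF _ n, of 0] by simp
      then obtain f where "f \<in> U" "norm (T n f) > 2/3 * D n"
        using zU bdd[of n] unfolding D_def by (subst (asm) less_cSUP_iff) auto
      then show ?thesis using n by (intro exI[of _ n] exI[of _ f]) auto
    qed
    then obtain n \<eta> where \<eta>: "\<And>j. \<eta> j \<in> U" "\<And>j. D (n j) > 4 ^ j"
      "\<And>j. norm (T (n j) (\<eta> j)) \<ge> 2/3 * D (n j)" by metis
    have \<eta>S: "\<eta> j \<in> S" for j using \<eta>(1) by (auto simp: U_def)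
    \<comment> \<open>\<open>P\<close> fixes the initial value within dependent choice: the
      construction has to start at the zero function for the sums of \<open>\<xi>\<close> to
      telescope to \<open>X\<close>.\<close>
    define P where "P j x \<longleftrightarrow> x \<in> S \<and> (j = 0 \<longrightarrow> x = (\<lambda>_. 0))" for j :: nat and x
    define Q where "Q j x y \<longleftrightarrow> (\<exists>s::complex. norm s = 1 \<and> y = (\<lambda>t. x t + (s * (1/3)^j) * \<eta> j t)) \<and>
       norm (T (n j) y) \<ge> (1/3)^j * norm (T (n j) (\<eta> j))" for j x y
    have "\<exists>X. \<forall>j. P j (X j) \<and> Q j (X j) (X (Suc j))"
    proof (rule dependent_nat_choice)
      show "\<exists>x. P 0 x" using zero by (auto simp: P_def)
    next
      fix x j assume "P j x"
      then have x: "x \<in> S" by (simp add: P_def)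
      define c :: complex where "c = (1/3)^j"
      define y where "y s = (\<lambda>t. x t + (s * c) * \<eta> j t)" for s
      have yS: "y s \<in> S" for s unfolding y_def using comb[OF x \<eta>S] by simp
      have Ty: "T (n j) (y s) = T (n j) x + s * (c * T (n j) (\<eta> j))" for s
        unfolding y_def by (subst T_lin[OF x \<eta>S]) simp
      let ?p = "T (n j) (y 1)" and ?q = "T (n j) (y (-1))" and ?r = "c * T (n j) (\<eta> j)"
      have "2 * ?r = ?p - ?q" by (simp add: Ty)
      then have "norm (2 * ?r) \<le> norm ?p + norm ?q" by (metis norm_triangle_ineq4)
      moreover have "norm (2 * ?r) = 2 * norm ?r" by (simp add: norm_mult)
      ultimately have "norm ?r \<le> norm ?p \<or> norm ?r \<le> norm ?q" by linarith
      then obtain s where s: "norm s = 1" "norm ?r \<le> norm (T (n j) (y s))"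
        by (metis norm_minus_cancel norm_one)
      have "Q j x (y s)" unfolding Q_def
        using s by (auto simp: y_def c_def norm_mult norm_power norm_divide)
      then show "\<exists>y. P (Suc j) y \<and> Q j x y" using yS by (auto simp: P_def)
    qed
    then obtain X where X: "\<And>j. X j \<in> S" "X 0 = (\<lambda>_. 0)" "\<And>j. Q j (X j) (X (Suc j))"
      by (auto simp: P_def)
    define \<xi> where "\<xi> j = (\<lambda>t. X (Suc j) t - X j t)" for j
    have \<xi>: "\<xi> j \<in> S \<and> N (\<xi> j) \<le> (1/3)^j" for j
    proof -
      from X(3)[of j] obtain s where s: "norm s = 1"
        "X (Suc j) = (\<lambda>t. X j t + (s * (1/3)^j) * \<eta> j t)" by (auto simp: Q_def)
      have eq: "\<xi> j = (\<lambda>t. (s * (1/3)^j) * \<eta> j t)" by (simp add: \<xi>_def s)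
      have "N (\<xi> j) = (1/3)^j * N (\<eta> j)"
        unfolding eq N_scale[OF \<eta>S] by (simp add: norm_mult s norm_power norm_divide)
      also have "\<dots> \<le> (1/3)^j * 1" using \<eta>(1)[of j] by (intro mult_left_mono) (auto simp: U_def)
      finally show ?thesis using smult[OF \<eta>S[of j]] eq by simp
    qed
    have tel: "(\<Sum>j<m. \<xi> j t) = X m t" for m t
      unfolding \<xi>_def using sum_lessThan_telescope[of "\<lambda>j. X j t" m] X(2) by simp
    from complete[of \<xi>] \<xi> obtain x where x: "x \<in> S"
      "\<And>m. N (\<lambda>t. x t - X m t) \<le> (1/3)^m * (3/2)" by (auto simp: tel)
    obtain M where M: "\<And>n. norm (T n x) \<le> M" using pointwise[OF x(1)] by blast
    \<comment> \<open>After step j the functional is at least (1/3)^j * 2/3 * D, and the remaining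
      steps change it by at most (1/3)^(j+1) * 3/2 * D = (1/3)^j * 1/2 * D. The difference 2/3 - 1/2
      = 1/6 survives, and D > 4^j makes it unbounded.\<close>
    have low: "(4/3)^j / 6 \<le> M" for j :: nat
    proof -
      let ?n = "n j" and ?d = "\<lambda>t. x t + (-1) * X (Suc j) t"
      have dS: "?d \<in> S" using comb[OF x(1) X(1), of "-1"] .
      have "N ?d \<le> (1/3)^j * (1/2)" using x(2)[of "Suc j"] by simp
      then have "norm (T ?n ?d) \<le> D ?n * ((1/3)^j * (1/2))"
        using D_bound[OF dS, of ?n] D_nonneg[of ?n] by (meson mult_left_mono order_trans)
      moreover have "norm (T ?n (X (Suc j))) \<ge> (1/3)^j * (2/3 * D ?n)"
        using X(3)[of j] \<eta>(3)[of j] unfolding Q_def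
        by (meson mult_left_mono order_trans zero_le_divide_1_iff zero_le_numeral zero_le_power)
      moreover have "norm (T ?n (X (Suc j))) \<le> norm (T ?n x) + norm (T ?n ?d)"
        using T_lin[OF x(1) X(1), of ?n "-1" "Suc j"] norm_triangle_ineq4[of "T ?n x" "T ?n ?d"]
        by simp
      ultimately have "norm (T ?n x) \<ge> (1/3)^j * D ?n / 6"
        by (simp add: algebra_simps)
      moreover have "(1/3)^j * D ?n \<ge> (1/3)^j * (4::real)^j"
        using \<eta>(2)[of j] by (intro mult_left_mono) auto
      moreover have "(1/3)^j * (4::real)^j = (4/3)^j" by (simp add: power_divide)
      ultimately show ?thesis using M[of ?n] by linarith
    qed
    obtain j where "(4/3::real)^j > 6 * M"
      using real_arch_pow[of "4/3" "6 * M"] by auto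
    then show False using low[of j] by simp
  qed
qed

section \<open>Trigonometric polynomials and functionals on the circle\<close>

lemma compact_circle: "compact circle"
  by (simp add: circle_def)

lemma cis_in_circle [simp]: "cis t \<in> circle"
  by (simp add: circle_def)

lemma one_in_circle [simp]: "1 \<in> circle"
  by (simp add: circle_def)

lemma circle_nonzero: "z \<in> circle \<Longrightarrow> z \<noteq> 0"
  by (auto simp: circle_def)

lemma circle_mult: "z \<in> circle \<Longrightarrow> w \<in> circle \<Longrightarrow> z * w \<in> circle"
  by (auto simp: circle_def norm_mult)

lemma circle_cnj: "z \<in> circle \<Longrightarrow> cnj z \<in> circle"
  by (auto simp: circle_def)

lemma circle_powi: "z \<in> circle \<Longrightarrow> norm (z powi k) = 1"
  by (auto simp: circle_def norm_power_int)

lemma circle_cisE: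
  assumes "z \<in> circle"
  obtains t where "t \<in> {0..2*pi}" "z = cis t"
proof
  show "Arg2pi z \<in> {0..2*pi}" using Arg2pi[of z] by (auto intro: less_imp_le)
  have "norm z = 1" using assms by (simp add: circle_def)
  then show "z = cis (Arg2pi z)"
    using Arg2pi_eq[of z] by (simp add: cis_conv_exp)
qed

lemma continuous_on_circle_powi [continuous_intros]: "continuous_on circle (\<lambda>z. z powi k)"
  by (intro continuous_intros) (auto simp: circle_nonzero)

lemma continuous_on_circle_cnj:
  "continuous_on circle f \<Longrightarrow> continuous_on circle (\<lambda>z. f (cnj z))"
  by (rule continuous_on_compose2[of circle f circle cnj])
     (auto intro!: continuous_intros simp: circle_cnj)

lemma continuous_on_circle_rotate:
  "continuous_on circle f \<Longrightarrow> w \<in> circle \<Longrightarrow> continuous_on circle (\<lambda>z. f (w * z))"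
  by (rule continuous_on_compose2[of circle f circle "\<lambda>z. w * z"])
     (auto intro!: continuous_intros simp: circle_mult)

lemma continuous_on_circle_bounded:
  fixes f :: "complex \<Rightarrow> complex"
  assumes "continuous_on circle f"
  obtains B where "B \<ge> 0" "\<And>z. z \<in> circle \<Longrightarrow> norm (f z) \<le> B"
proof -
  have "bounded (f ` circle)"
    by (intro compact_imp_bounded compact_continuous_image assms compact_circle)
  then show thesis using that unfolding bounded_pos by (meson imageI less_imp_le)
qed

section \<open>Trigonometric polynomials and their density in C(T)\<close>

inductive trig_poly :: "(complex \<Rightarrow> complex) \<Rightarrow> bool" where
  powi: "trig_poly (\<lambda>z. z powi k)"
| add: "trig_poly p \<Longrightarrow> trig_poly q \<Longrightarrow> trig_poly (\<lambda>z. p z + q z)"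
| cmult: "trig_poly p \<Longrightarrow> trig_poly (\<lambda>z. c * p z)"

lemma trig_poly_continuous: "trig_poly p \<Longrightarrow> continuous_on circle p"
  by (induction rule: trig_poly.induct) (auto intro!: continuous_intros simp: circle_nonzero)

text \<open>Exponents of characters add only away from 0, so the product is identified with a
  trigonometric polynomial on the circle and not as a function on the plane.\<close>

lemma trig_poly_mult_powi:
  "trig_poly q \<Longrightarrow> \<exists>r. trig_poly r \<and> (\<forall>z\<in>circle. z powi k * q z = r z)"
proof (induction rule: trig_poly.induct)
  case (powi m)
  have "z powi k * z powi m = z powi (k + m)" if "z \<in> circle" for z
    using circle_nonzero[OF that] by (simp add: power_int_add)
  then show ?case using trig_poly.powi by blast
next
  case (add p q)
  then obtain r s where "trig_poly r" "\<forall>z\<in>circle. z powi k * p z = r z"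
    "trig_poly s" "\<forall>z\<in>circle. z powi k * q z = s z" by blast
  then show ?case
    by (intro exI[of _ "\<lambda>z. r z + s z"]) (auto simp: distrib_left intro: trig_poly.add)
next
  case (cmult p c)
  then obtain r where "trig_poly r" "\<forall>z\<in>circle. z powi k * p z = r z" by blast
  then show ?case
    by (intro exI[of _ "\<lambda>z. c * r z"]) (auto simp: mult.left_commute intro: trig_poly.cmult)
qed

lemma trig_poly_mult:
  assumes "trig_poly p" "trig_poly q"
  shows "\<exists>r. trig_poly r \<and> (\<forall>z\<in>circle. p z * q z = r z)"
  using assms(1)
proof (induction rule: trig_poly.induct)
  case (powi k)
  then show ?case using trig_poly_mult_powi[OF assms(2)] .
next
  case (add p p')
  then obtain r s where "trig_poly r" "\<forall>z\<in>circle. p z * q z = r z"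
    "trig_poly s" "\<forall>z\<in>circle. p' z * q z = s z" by blast
  then show ?case
    by (intro exI[of _ "\<lambda>z. r z + s z"]) (auto simp: distrib_right intro: trig_poly.add)
next
  case (cmult p c)
  then obtain r where "trig_poly r" "\<forall>z\<in>circle. p z * q z = r z" by blast
  then show ?case
    by (intro exI[of _ "\<lambda>z. c * r z"]) (auto simp: mult.assoc intro: trig_poly.cmult)
qed

text \<open>On the circle \<open>cnj z\<close> is \<open>inverse z\<close>, so both real coordinates
  are combinations of \<open>z powi 1\<close> and \<open>z powi (-1)\<close>; the rest is closure
  under sums and products.\<close>

lemma real_polynomial_function_trig_poly:
  fixes h :: "complex \<Rightarrow> real"
  assumes "real_polynomial_function h"
  shows "\<exists>p. trig_poly p \<and> (\<forall>z\<in>circle. of_real (h z) = p z)"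
  using assms
proof (induction rule: real_polynomial_function.induct)
  case (linear h)
  define a b where "a = complex_of_real (h 1)" and "b = complex_of_real (h \<i>)"
  \<comment> \<open>The coefficients come from putting Re z = (z + cnj z)/2 and Im z = (z - cnj
    z)/(2*\<i>) into \<open>Re z * h 1 + Im z * h \<i>\<close>.\<close>
  define p where "p z = (a/2 + b/(2*\<i>)) * z powi 1 + (a/2 - b/(2*\<i>)) * z powi (-1)" for z
  have "of_real (h z) = p z" if z: "z \<in> circle" for z
  proof -
    interpret bounded_linear h by fact
    have "z = Re z *\<^sub>R 1 + Im z *\<^sub>R \<i>" by (simp add: complex_eq_iff)
    then have "h z = Re z * h 1 + Im z * h \<i>" by (metis add real_scaleR_def scaleR)
    then have 1: "of_real (h z) = of_real (Re z) * a + of_real (Im z) * b"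
      by (simp add: a_def b_def)
    have "norm z = 1" using z by (simp add: circle_def)
    then have "z * cnj z = 1" using complex_norm_square[of z] by simp
    then have "inverse z = cnj z" by (rule inverse_unique)
    then have 2: "p z = (a/2 + b/(2*\<i>)) * z + (a/2 - b/(2*\<i>)) * cnj z"
      by (simp add: p_def power_int_minus)
    have 3: "of_real (Re z) = (z + cnj z) / 2" "of_real (Im z) = (z - cnj z) / (2*\<i>)"
      by (simp_all add: complex_eq_iff)
    show ?thesis unfolding 1 2 3 by (simp add: field_simps)
  qed
  moreover have "trig_poly p"
    unfolding p_def by (intro trig_poly.intros)
  ultimately show ?case by blast
next
  case (const c)
  have "trig_poly (\<lambda>z. of_real c * z powi 0)" by (intro trig_poly.intros)
  then show ?case by (intro exI[of _ "\<lambda>z. of_real c * z powi 0"]) auto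
next
  case (add f g)
  then obtain r s where "trig_poly r" "\<forall>z\<in>circle. of_real (f z) = r z"
    "trig_poly s" "\<forall>z\<in>circle. of_real (g z) = s z" by blast
  then show ?case by (intro exI[of _ "\<lambda>z. r z + s z"]) (auto intro: trig_poly.add)
next
  case (mult f g)
  then obtain r s where rs: "trig_poly r" "\<forall>z\<in>circle. of_real (f z) = r z"
    "trig_poly s" "\<forall>z\<in>circle. of_real (g z) = s z" by blast
  obtain u where "trig_poly u" "\<forall>z\<in>circle. r z * s z = u z"
    using trig_poly_mult[OF rs(1,3)] by blast
  with rs show ?case by (intro exI[of _ u]) auto
qed

text \<open>Stone-Weierstrass supplies a polynomial in the two plane coordinates; its real and
  imaginary parts are trigonometric polynomials on the circle.\<close>

lemma trig_poly_dense:
  fixes f :: "complex \<Rightarrow> complex"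
  assumes f: "continuous_on circle f" and e: "e > 0"
  obtains p where "trig_poly p" "\<And>z. z \<in> circle \<Longrightarrow> norm (f z - p z) < e"
proof -
  obtain g where g: "polynomial_function g" "\<And>z. z \<in> circle \<Longrightarrow> norm (f z - g z) < e"
    using Stone_Weierstrass_polynomial_function[OF compact_circle f e] by blast
  have "real_polynomial_function (Re \<circ> g)" "real_polynomial_function (Im \<circ> g)"
    using g(1) bounded_linear_Re bounded_linear_Im by (auto simp: polynomial_function_def)
  then obtain p q where pq: "trig_poly p" "\<forall>z\<in>circle. of_real (Re (g z)) = p z"
    "trig_poly q" "\<forall>z\<in>circle. of_real (Im (g z)) = q z"
    using real_polynomial_function_trig_poly[of "Re \<circ> g"] real_polynomial_function_trig_poly[of "Im \<circ> g"]
    unfolding comp_apply by blast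
  have "g z = p z + \<i> * q z" if "z \<in> circle" for z
    using pq that complex_eq[of "g z"] by auto
  then show thesis
    using that[of "\<lambda>z. p z + \<i> * q z"] g(2) trig_poly.add[OF pq(1) trig_poly.cmult[OF pq(3)]]
    by simp
qed

section \<open>Bounded linear functionals on C(T)\<close>

lemma CT_dual_add: "CT_dual \<phi> \<Longrightarrow> continuous_on circle f \<Longrightarrow> continuous_on circle g \<Longrightarrow>
    \<phi> (\<lambda>z. f z + g z) = \<phi> f + \<phi> g"
  and CT_dual_cmult: "CT_dual \<phi> \<Longrightarrow> continuous_on circle f \<Longrightarrow> \<phi> (\<lambda>z. c * f z) = c * \<phi> f"
  and CT_dual_cong: "CT_dual \<phi> \<Longrightarrow> continuous_on circle f \<Longrightarrow> continuous_on circle g \<Longrightarrow>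
    (\<And>z. z \<in> circle \<Longrightarrow> f z = g z) \<Longrightarrow> \<phi> f = \<phi> g"
  unfolding CT_dual_def by blast+

text \<open>The circle is nonempty, so an admissible B is nonnegative and the constant may be
  enlarged; a positive constant can be divided by in epsilon arguments.\<close>

lemma CT_dual_bounded:
  assumes "CT_dual \<phi>"
  obtains C where "C > 0" "\<And>f B. continuous_on circle f \<Longrightarrow>
    (\<And>z. z \<in> circle \<Longrightarrow> norm (f z) \<le> B) \<Longrightarrow> norm (\<phi> f) \<le> C * B"
proof -
  obtain C where C: "\<And>f B. continuous_on circle f \<Longrightarrow> (\<forall>z\<in>circle. norm (f z) \<le> B) \<Longrightarrow>
      norm (\<phi> f) \<le> C * B"
    using assms unfolding CT_dual_def by blast
  have "norm (\<phi> f) \<le> (\<bar>C\<bar> + 1) * B"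
    if f: "continuous_on circle f" "\<And>z. z \<in> circle \<Longrightarrow> norm (f z) \<le> B" for f B
  proof -
    have "0 \<le> B" using f(2)[OF one_in_circle] norm_ge_zero order_trans by blast
    then have "C * B \<le> (\<bar>C\<bar> + 1) * B" by (intro mult_right_mono) auto
    then show ?thesis using C[of f B] f by simp
  qed
  then show thesis using that[of "\<bar>C\<bar> + 1"] by simp
qed

lemma CT_dual_diff:
  assumes "CT_dual \<phi>" "continuous_on circle f" "continuous_on circle g"
  shows "\<phi> (\<lambda>z. f z - g z) = \<phi> f - \<phi> g"
proof -
  have "\<phi> (\<lambda>z. f z + (-1) * g z) = \<phi> f + (-1) * \<phi> g"
    using assms by (subst CT_dual_add) (auto intro!: continuous_intros simp only: CT_dual_cmult)
  then show ?thesis by simp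
qed

text \<open>The filter is arbitrary because the result serves both sequences and the net of finite
  index sets of a series.\<close>

lemma CT_dual_tendsto:
  assumes \<phi>: "CT_dual \<phi>" and F: "\<And>i. continuous_on circle (F i)" and f: "continuous_on circle f"
    and lim: "uniform_limit circle F f G"
  shows "((\<lambda>i. \<phi> (F i)) \<longlongrightarrow> \<phi> f) G"
proof (rule tendstoI)
  fix e :: real assume e: "e > 0"
  obtain C where C: "C > 0" "\<And>f B. continuous_on circle f \<Longrightarrow>
    (\<And>z. z \<in> circle \<Longrightarrow> norm (f z) \<le> B) \<Longrightarrow> norm (\<phi> f) \<le> C * B"
    using CT_dual_bounded[OF \<phi>] by blast
  have "e / (2 * C) > 0" using e C by simp
  from uniform_limitD[OF lim this]
  show "\<forall>\<^sub>F i in G. dist (\<phi> (F i)) (\<phi> f) < e"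
  proof eventually_elim
    case (elim i)
    have "norm (\<phi> (\<lambda>z. F i z - f z)) \<le> C * (e / (2 * C))"
      by (rule C(2)) (use elim F f in \<open>auto intro!: continuous_intros simp: dist_norm less_imp_le\<close>)
    also have "\<dots> < e" using e C by simp
    finally show ?case using CT_dual_diff[OF \<phi> F f] by (simp add: dist_norm)
  qed
qed

lemma CT_dual_sum:
  assumes \<phi>: "CT_dual \<phi>" and "finite F"
  shows "\<phi> (\<lambda>z. \<Sum>k\<in>F. c k * z powi k) = (\<Sum>k\<in>F. c k * \<phi> (\<lambda>z. z powi k))"
  using \<open>finite F\<close>
proof (induction F rule: finite_induct)
  case empty
  then show ?case using CT_dual_cmult[OF \<phi> continuous_on_const, of 0] by simp
next
  case (insert k F)
  have "\<phi> (\<lambda>z. c k * z powi k + (\<Sum>k\<in>F. c k * z powi k)) =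
      c k * \<phi> (\<lambda>z. z powi k) + \<phi> (\<lambda>z. \<Sum>k\<in>F. c k * z powi k)"
    by (subst CT_dual_add[OF \<phi>])
      (auto intro!: continuous_intros simp: circle_nonzero CT_dual_cmult[OF \<phi> continuous_on_circle_powi])
  then show ?case using insert by simp
qed

lemma uniform_limit_powi_series:
  fixes c :: "int \<Rightarrow> complex"
  assumes "(\<lambda>k. norm (c k)) summable_on UNIV"
  shows "uniform_limit circle (\<lambda>F z. \<Sum>k\<in>F. c k * z powi k) (\<lambda>z. \<Sum>\<^sub>\<infinity>k. c k * z powi k)
    (finite_subsets_at_top UNIV)"
  by (rule Weierstrass_m_test_general[where M = "\<lambda>k. norm (c k)"])
     (auto simp: norm_mult circle_powi assms)

lemma continuous_on_powi_series:
  fixes c :: "int \<Rightarrow> complex"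
  assumes "(\<lambda>k. norm (c k)) summable_on UNIV"
  shows "continuous_on circle (\<lambda>z. \<Sum>\<^sub>\<infinity>k. c k * z powi k)"
  by (rule uniform_limit_theorem[OF _ uniform_limit_powi_series[OF assms]])
     (auto intro!: continuous_intros always_eventually simp: circle_nonzero)

text \<open>Absolute summability makes the finite partial sums converge uniformly on the circle, and
  continuity carries the functional inside the series.\<close>

lemma CT_dual_powi_series:
  fixes c :: "int \<Rightarrow> complex"
  assumes \<phi>: "CT_dual \<phi>" and c: "(\<lambda>k. norm (c k)) summable_on UNIV"
  shows "\<phi> (\<lambda>z. \<Sum>\<^sub>\<infinity>k. c k * z powi k) = (\<Sum>\<^sub>\<infinity>k. c k * \<phi> (\<lambda>z. z powi k))"
proof -
  have "((\<lambda>F. \<phi> (\<lambda>z. \<Sum>k\<in>F. c k * z powi k)) \<longlongrightarrow> \<phi> (\<lambda>z. \<Sum>\<^sub>\<infinity>k. c k * z powi k))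
      (finite_subsets_at_top UNIV)"
    by (rule CT_dual_tendsto[OF \<phi> _ continuous_on_powi_series[OF c] uniform_limit_powi_series[OF c]])
       (auto intro!: continuous_intros simp: circle_nonzero)
  also have "?this \<longleftrightarrow> ((\<lambda>F. \<Sum>k\<in>F. c k * \<phi> (\<lambda>z. z powi k)) \<longlongrightarrow> \<phi> (\<lambda>z. \<Sum>\<^sub>\<infinity>k. c k * z powi k))
      (finite_subsets_at_top UNIV)"
    by (rule tendsto_cong[OF eventually_finite_subsets_at_top_weakI]) (rule CT_dual_sum[OF \<phi>])
  finally have "((\<lambda>k. c k * \<phi> (\<lambda>z. z powi k)) has_sum \<phi> (\<lambda>z. \<Sum>\<^sub>\<infinity>k. c k * z powi k)) UNIV"
    by (simp add: has_sum_def)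
  then show ?thesis by (simp add: infsumI)
qed

text \<open>By density of trigonometric polynomials, identities between functionals need checking on
  characters only. This replaces changes of variables under the integral in the laws for Fourier
  coefficients.\<close>

lemma CT_dual_eqI:
  assumes \<phi>: "CT_dual \<phi>" and \<psi>: "CT_dual \<psi>"
    and eq: "\<And>k. \<phi> (\<lambda>z. z powi k) = \<psi> (\<lambda>z. z powi k)" and f: "continuous_on circle f"
  shows "\<phi> f = \<psi> f"
proof -
  have trig: "\<phi> p = \<psi> p" if "trig_poly p" for p
    using that
  proof induction
    case (powi k)
    show ?case by (rule eq)
  next
    case (add p q)
    then show ?case
      using CT_dual_add[OF \<phi>, of p q] CT_dual_add[OF \<psi>, of p q] by (simp add: trig_poly_continuous)
  next
    case (cmult p c)
    then show ?case
      using CT_dual_cmult[OF \<phi>, of p c] CT_dual_cmult[OF \<psi>, of p c] by (simp add: trig_poly_continuous)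
  qed
  have "\<exists>p. trig_poly p \<and> (\<forall>z\<in>circle. norm (f z - p z) < inverse (Suc n))" for n
    by (rule trig_poly_dense[OF f, of "inverse (Suc n)"]) auto
  then obtain p where p: "\<And>n. trig_poly (p n)"
    "\<And>n z. z \<in> circle \<Longrightarrow> norm (f z - p n z) < inverse (Suc n)" by metis
  have lim: "uniform_limit circle p f sequentially"
  proof (rule uniform_limitI)
    fix e :: real assume "e > 0"
    then have "\<forall>\<^sub>F n in sequentially. inverse (real (Suc n)) < e"
      using LIMSEQ_inverse_real_of_nat order_tendstoD(2) by blast
    then show "\<forall>\<^sub>F n in sequentially. \<forall>z\<in>circle. dist (p n z) (f z) < e"
    proof eventually_elim
      case (elim n)
      then show ?case using p(2)[of _ n] by (fastforce simp: dist_norm norm_minus_commute)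
    qed
  qed
  have "(\<lambda>n. \<phi> (p n)) \<longlonglongrightarrow> \<phi> f" "(\<lambda>n. \<psi> (p n)) \<longlonglongrightarrow> \<psi> f"
    by (rule CT_dual_tendsto[OF \<phi> trig_poly_continuous[OF p(1)] f lim],
        rule CT_dual_tendsto[OF \<psi> trig_poly_continuous[OF p(1)] f lim])
  then show ?thesis unfolding trig[OF p(1)] by (rule LIMSEQ_unique)
qed

section \<open>Integration over a period\<close>

text \<open>Restricting the measure makes it a finite measure to which general integration theory
  applies. Both endpoints are kept, so the point 1 of the circle occurs twice, which is a null
  event.\<close>

abbreviation period_measure :: "real measure" where
  "period_measure \<equiv> restrict_space lborel {0..2*pi}"

lemma finite_measure_period_measure: "finite_measure period_measure"
  by (rule finite_measureI) (simp add: space_restrict_space emeasure_restrict_space)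

lemma set_integral_period: "(LINT t:{0..2*pi}|lborel. f t) = integral\<^sup>L period_measure f"
  for f :: "real \<Rightarrow> 'a::{banach, second_countable_topology}"
  by (simp add: set_lebesgue_integral_def integral_restrict_space)

lemma L1_T_iff: "L1_T g \<longleftrightarrow> integrable period_measure (\<lambda>t. g (cis t))"
  by (simp add: L1_T_def set_integrable_def integrable_restrict_space)

lemma L1_norm_eq: "L1_norm g = (\<integral>t. norm (g (cis t)) \<partial>period_measure) / (2*pi)"
  by (simp add: L1_norm_def set_integral_period)

lemma L1_norm_nonneg: "0 \<le> L1_norm g"
  by (simp add: L1_norm_eq)

lemma pair_L1_eq: "pair_L1 f g = (\<integral>t. f (cnj (cis t)) * g (cis t) \<partial>period_measure) / (2*pi)"
  by (simp add: pair_L1_def set_integral_period)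

lemma continuous_on_cis_comp:
  assumes "continuous_on circle f"
  shows "continuous_on UNIV (\<lambda>t. f (cis t))"
  by (rule continuous_on_compose2[OF assms, of UNIV cis]) (auto intro!: continuous_intros)

lemma measurable_period_continuous:
  fixes f :: "complex \<Rightarrow> 'a::real_normed_vector"
  assumes "continuous_on circle f"
  shows "(\<lambda>t. f (cis t)) \<in> borel_measurable period_measure"
  by (intro measurable_restrict_space1) (simp add: borel_measurable_continuous_onI[OF continuous_on_cis_comp[OF assms]])

lemma integrable_period_mult:
  fixes f :: "complex \<Rightarrow> complex"
  assumes f: "continuous_on circle f" and g: "integrable period_measure g"
  shows "integrable period_measure (\<lambda>t. f (cis t) * g t)"
proof -
  obtain B where B: "B \<ge> 0" "\<And>z. z \<in> circle \<Longrightarrow> norm (f z) \<le> B"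
    using continuous_on_circle_bounded[OF f] by blast
  show ?thesis
  proof (rule Bochner_Integration.integrable_bound)
    show "integrable period_measure (\<lambda>t. of_real B * g t)" using g by simp
    show "(\<lambda>t. f (cis t) * g t) \<in> borel_measurable period_measure"
      using measurable_period_continuous[OF f] g by measurable
    show "AE t in period_measure. norm (f (cis t) * g t) \<le> norm (of_real B * g t)"
      using B by (intro AE_I2) (auto simp: norm_mult intro!: mult_right_mono)
  qed
qed

lemma integrable_period_pair:
  fixes f :: "complex \<Rightarrow> complex"
  assumes "continuous_on circle f" and "integrable period_measure g"
  shows "integrable period_measure (\<lambda>t. f (cnj (cis t)) * g t)"
  using integrable_period_mult[OF continuous_on_circle_cnj[OF assms(1)] assms(2)] .

lemma continuous_imp_L1_T: "continuous_on circle f \<Longrightarrow> L1_T f"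
  using integrable_period_mult[of f "\<lambda>_. 1", OF _ finite_measure.integrable_const[OF finite_measure_period_measure]]
  by (simp add: L1_T_iff)

lemma L1_T_lincomb: "L1_T f \<Longrightarrow> L1_T g \<Longrightarrow> L1_T (\<lambda>z. f z + c * g z)"
  by (simp add: L1_T_iff)

lemma L1_norm_cmult: "L1_norm (\<lambda>z. c * g z) = norm c * L1_norm g"
  by (simp add: L1_norm_eq norm_mult)

lemma L1_norm_triangle:
  assumes "L1_T f" "L1_T g"
  shows "L1_norm (\<lambda>z. f z + g z) \<le> L1_norm f + L1_norm g"
proof -
  have "(\<integral>t. norm (f (cis t) + g (cis t)) \<partial>period_measure) \<le> (\<integral>t. norm (f (cis t)) + norm (g (cis t)) \<partial>period_measure)"
    using assms by (intro integral_mono) (auto simp: L1_T_iff norm_triangle_ineq)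
  also have "\<dots> = (\<integral>t. norm (f (cis t)) \<partial>period_measure) + (\<integral>t. norm (g (cis t)) \<partial>period_measure)"
    using assms by (intro Bochner_Integration.integral_add) (auto simp: L1_T_iff)
  finally show ?thesis by (simp add: L1_norm_eq divide_right_mono flip: add_divide_distrib)
qed

lemma integral_period_const: "(\<integral>t. c \<partial>period_measure) = 2 * pi * c" for c :: real
  by (simp add: space_restrict_space measure_restrict_space)

lemma L1_norm_le_sup:
  assumes f: "L1_T f" and B: "\<And>z. z \<in> circle \<Longrightarrow> norm (f z) \<le> B"
  shows "L1_norm f \<le> B"
proof -
  have "(\<integral>t. norm (f (cis t)) \<partial>period_measure) \<le> (\<integral>t. B \<partial>period_measure)"
    using f B by (intro integral_mono) (auto simp: L1_T_iff finite_measure.integrable_const[OF finite_measure_period_measure])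
  then show ?thesis by (simp only: integral_period_const L1_norm_eq) (simp add: field_simps)
qed

lemma pair_L1_bound:
  assumes f: "continuous_on circle f" and g: "L1_T g" and B: "\<And>z. z \<in> circle \<Longrightarrow> norm (f z) \<le> B"
  shows "norm (pair_L1 f g) \<le> B * L1_norm g"
proof -
  have "norm (\<integral>t. f (cnj (cis t)) * g (cis t) \<partial>period_measure) \<le> (\<integral>t. norm (f (cnj (cis t)) * g (cis t)) \<partial>period_measure)"
    by (rule integral_norm_bound)
  also have "\<dots> \<le> (\<integral>t. B * norm (g (cis t)) \<partial>period_measure)"
    using g f B[of "cnj (cis _)"]
    by (intro integral_mono integrable_norm integrable_period_pair)
       (auto simp: L1_T_iff norm_mult circle_cnj intro!: mult_right_mono)
  finally show ?thesis by (simp add: pair_L1_eq L1_norm_eq norm_divide field_simps)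
qed

lemma pair_L1_add_right:
  assumes "continuous_on circle f" "L1_T g" "L1_T h"
  shows "pair_L1 f (\<lambda>z. g z + c * h z) = pair_L1 f g + c * pair_L1 f h"
proof -
  have "(\<integral>t. f (cnj (cis t)) * (g (cis t) + c * h (cis t)) \<partial>period_measure) =
      (\<integral>t. f (cnj (cis t)) * g (cis t) + c * (f (cnj (cis t)) * h (cis t)) \<partial>period_measure)"
    by (simp add: algebra_simps)
  also have "\<dots> = (\<integral>t. f (cnj (cis t)) * g (cis t) \<partial>period_measure) + c * (\<integral>t. f (cnj (cis t)) * h (cis t) \<partial>period_measure)"
    using assms by (subst Bochner_Integration.integral_add)
      (auto simp: L1_T_iff intro!: integrable_period_pair integrable_mult_right)
  finally show ?thesis by (simp add: pair_L1_eq add_divide_distrib)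
qed

lemma pair_L1_add_left:
  assumes "continuous_on circle f" "continuous_on circle h" "L1_T g"
  shows "pair_L1 (\<lambda>z. f z + h z) g = pair_L1 f g + pair_L1 h g"
proof -
  have "(\<integral>t. (f (cnj (cis t)) + h (cnj (cis t))) * g (cis t) \<partial>period_measure) =
      (\<integral>t. f (cnj (cis t)) * g (cis t) + h (cnj (cis t)) * g (cis t) \<partial>period_measure)"
    by (simp add: algebra_simps)
  also have "\<dots> = (\<integral>t. f (cnj (cis t)) * g (cis t) \<partial>period_measure) + (\<integral>t. h (cnj (cis t)) * g (cis t) \<partial>period_measure)"
    using assms by (intro Bochner_Integration.integral_add integrable_period_pair)
      (auto simp: L1_T_iff)
  finally show ?thesis by (simp add: pair_L1_eq add_divide_distrib)
qed

lemma pair_L1_cong: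
  "(\<And>z. z \<in> circle \<Longrightarrow> f z = f' z) \<Longrightarrow> (\<And>z. z \<in> circle \<Longrightarrow> g z = g' z) \<Longrightarrow> pair_L1 f g = pair_L1 f' g'"
  by (simp add: pair_L1_eq circle_cnj)

lemma CT_dual_pair_L1_left:
  assumes "L1_T g"
  shows "CT_dual (\<lambda>f. pair_L1 f g)"
  unfolding CT_dual_def
proof (intro conjI allI impI exI[of _ "L1_norm g"])
  fix f h :: "complex \<Rightarrow> complex" and c :: complex and B :: real
  assume f: "continuous_on circle f"
  show "pair_L1 (\<lambda>z. c * f z) g = c * pair_L1 f g" by (simp add: pair_L1_eq mult.assoc)
  {
    assume h: "continuous_on circle h"
    show "pair_L1 (\<lambda>z. f z + h z) g = pair_L1 f g + pair_L1 h g"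
      using pair_L1_add_left[OF f h assms] .
  }
  {
    assume "\<forall>z\<in>circle. f z = h z"
    then show "pair_L1 f g = pair_L1 h g" by (intro pair_L1_cong) auto
  }
  {
    assume "\<forall>z\<in>circle. norm (f z) \<le> B"
    then show "norm (pair_L1 f g) \<le> L1_norm g * B"
      using pair_L1_bound[OF f assms, of B] by (simp add: mult.commute)
  }
qed

text \<open>Here f is fixed and the density varies over C(T). In this orientation
  \<open>pair_L1 f\<close> can be applied termwise to the series defining T_n, and each Fourier
  coefficient becomes a functional on C(T).\<close>

lemma CT_dual_pair_L1_right:
  assumes f: "continuous_on circle f"
  shows "CT_dual (pair_L1 f)"
proof -
  obtain C where C: "C \<ge> 0" "\<And>z. z \<in> circle \<Longrightarrow> norm (f z) \<le> C"
    using continuous_on_circle_bounded[OF f] by blast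
  show ?thesis
    unfolding CT_dual_def
  proof (intro conjI allI impI exI[of _ C])
    fix g h :: "complex \<Rightarrow> complex" and c :: complex and B :: real
    assume g: "continuous_on circle g"
    show "pair_L1 f (\<lambda>z. c * g z) = c * pair_L1 f g" by (simp add: pair_L1_eq mult.left_commute)
    {
      assume "continuous_on circle h"
      then show "pair_L1 f (\<lambda>z. g z + h z) = pair_L1 f g + pair_L1 f h"
        using pair_L1_add_right[OF f continuous_imp_L1_T[OF g] continuous_imp_L1_T, of h 1] by simp
    }
    {
      assume "\<forall>z\<in>circle. g z = h z"
      then show "pair_L1 f g = pair_L1 f h" by (intro pair_L1_cong) auto
    }
    {
      assume "\<forall>z\<in>circle. norm (g z) \<le> B"
      then have "L1_norm g \<le> B" using L1_norm_le_sup[OF continuous_imp_L1_T[OF g]] by blast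
      then have "C * L1_norm g \<le> C * B" using C by (intro mult_left_mono)
      with pair_L1_bound[OF f continuous_imp_L1_T[OF g] C(2)]
      show "norm (pair_L1 f g) \<le> C * B" by linarith
    }
  qed
qed

lemma CT_dual_eval: "w \<in> circle \<Longrightarrow> CT_dual (\<lambda>f. f w)"
  unfolding CT_dual_def by (auto intro!: exI[of _ 1])

text \<open>Keeps rotated functionals within the scope of comparison on characters.\<close>

lemma CT_dual_rotate:
  assumes \<phi>: "CT_dual \<phi>" and w: "w \<in> circle"
  shows "CT_dual (\<lambda>f. \<phi> (\<lambda>z. f (w * z)))"
proof -
  obtain C where C: "C > 0" "\<And>f B. continuous_on circle f \<Longrightarrow>
    (\<And>z. z \<in> circle \<Longrightarrow> norm (f z) \<le> B) \<Longrightarrow> norm (\<phi> f) \<le> C * B"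
    using CT_dual_bounded[OF \<phi>] by blast
  show ?thesis
    unfolding CT_dual_def
  proof (intro conjI allI impI exI[of _ C])
    fix g h :: "complex \<Rightarrow> complex" and c :: complex and B :: real
    assume g: "continuous_on circle g"
    note g' = continuous_on_circle_rotate[OF g w]
    show "\<phi> (\<lambda>z. c * g (w * z)) = c * \<phi> (\<lambda>z. g (w * z))" by (rule CT_dual_cmult[OF \<phi> g'])
    {
      assume h: "continuous_on circle h"
      note h' = continuous_on_circle_rotate[OF h w]
      show "\<phi> (\<lambda>z. g (w * z) + h (w * z)) = \<phi> (\<lambda>z. g (w * z)) + \<phi> (\<lambda>z. h (w * z))"
        by (rule CT_dual_add[OF \<phi> g' h'])
      assume "\<forall>z\<in>circle. g z = h z"
      then show "\<phi> (\<lambda>z. g (w * z)) = \<phi> (\<lambda>z. h (w * z))"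
        by (intro CT_dual_cong[OF \<phi> g' h']) (auto simp: circle_mult w)
    }
    {
      assume "\<forall>z\<in>circle. norm (g z) \<le> B"
      then show "norm (\<phi> (\<lambda>z. g (w * z))) \<le> C * B"
        by (intro C(2)[OF g']) (auto simp: circle_mult w)
    }
  qed
qed

section \<open>Fourier coefficients as pairings with characters\<close>

lemma cis_powi: "cis t powi k = cis (of_int k * t)"
  by (simp add: cis_power_int)

text \<open>The conjugation built into the pairing turns \<open>z powi k\<close> into the factor
  e^(-ikt) of the coefficient.\<close>

lemma fourier_coeff_eq_pair: "fourier_coeff g k = pair_L1 (\<lambda>z. z powi k) g"
proof -
  have "cnj (cis t) powi k = cis (- (of_int k * t))" for t
    by (simp add: cis_cnj cis_powi)
  then show ?thesis
    by (simp add: fourier_coeff_def pair_L1_def mult.commute)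
qed

lemma CT_dual_fourier_coeff: "CT_dual (\<lambda>f. fourier_coeff f k)"
  unfolding fourier_coeff_eq_pair
  using CT_dual_pair_L1_right[OF continuous_on_circle_powi] .

lemma fourier_coeff_bound: "L1_T g \<Longrightarrow> norm (fourier_coeff g k) \<le> L1_norm g"
  unfolding fourier_coeff_eq_pair
  using pair_L1_bound[OF continuous_on_circle_powi, of g k 1] by (simp add: circle_powi)

lemma integral_period_cis:
  assumes "m \<noteq> 0"
  shows "(\<integral>t. cis (of_int m * t) \<partial>period_measure) = 0"
proof -
  define F where "F t = cis (of_int m * t) / (\<i> * of_int m)" for t :: real
  have "(\<integral>t. cis (of_int m * t) \<partial>period_measure) = (\<integral>t. indicator {0..2*pi} t *\<^sub>R cis (of_int m * t) \<partial>lborel)"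
    by (simp add: integral_restrict_space)
  also have "\<dots> = F (2*pi) - F 0"
  proof (rule integral_FTC_Icc)
    fix t :: real assume "0 \<le> t" "t \<le> 2*pi"
    show "(F has_vector_derivative cis (of_int m * t)) (at t within {0..2*pi})"
      unfolding F_def cis_conv_exp using assms
      by (auto intro!: derivative_eq_intros has_vector_derivative_real_field simp: mult_ac)
  qed (auto intro!: continuous_intros simp: cis_conv_exp)
  also have "\<dots> = 0"
  proof -
    have "cis (of_int m * (2*pi)) = 1"
      by (metis cis_2pi cis_power_int power_int_1_left)
    then show ?thesis by (simp add: F_def)
  qed
  finally show ?thesis .
qed

lemma fourier_coeff_powi: "fourier_coeff (\<lambda>z. z powi m) k = (if m = k then 1 else 0)"
proof -
  have "cnj (cis t) powi k * cis t powi m = cis (of_int (m - k) * t)" for t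
    by (simp add: cis_cnj cis_powi cis_mult algebra_simps)
  then have "fourier_coeff (\<lambda>z. z powi m) k = (\<integral>t. cis (of_int (m - k) * t) \<partial>period_measure) / (2*pi)"
    unfolding fourier_coeff_eq_pair pair_L1_eq by simp
  then show ?thesis
    using integral_period_cis[of "m - k"]
    by (auto simp: space_restrict_space measure_restrict_space scaleR_conv_of_real)
qed

text \<open>Symmetry of the pairing against a character, in effect the substitution t -> -t over a
  period. On characters both sides are the same Kronecker delta.\<close>

lemma pair_L1_powi_right:
  assumes f: "continuous_on circle f"
  shows "pair_L1 f (\<lambda>z. z powi k) = fourier_coeff f k"
proof (rule CT_dual_eqI[OF _ _ _ f])
  show "CT_dual (\<lambda>f. pair_L1 f (\<lambda>z. z powi k))"
    by (intro CT_dual_pair_L1_left continuous_imp_L1_T continuous_on_circle_powi)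
  show "CT_dual (\<lambda>f. fourier_coeff f k)" by (rule CT_dual_fourier_coeff)
  show "pair_L1 (\<lambda>z. z powi m) (\<lambda>z. z powi k) = fourier_coeff (\<lambda>z. z powi m) k" for m
    unfolding fourier_coeff_eq_pair[symmetric] by (simp add: fourier_coeff_powi)
qed

lemma fourier_coeff_rotate:
  assumes f: "continuous_on circle f" and w: "w \<in> circle"
  shows "fourier_coeff (\<lambda>z. f (w * z)) k = w powi k * fourier_coeff f k"
proof (rule CT_dual_eqI[OF _ _ _ f])
  show "CT_dual (\<lambda>f. fourier_coeff (\<lambda>z. f (w * z)) k)"
    by (rule CT_dual_rotate[OF CT_dual_fourier_coeff w])
  have 1: "continuous_on circle (\<lambda>z. w powi k * z powi k)"
    by (intro continuous_intros) (auto simp: circle_nonzero)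
  show "CT_dual (\<lambda>f. w powi k * fourier_coeff f k)"
    using CT_dual_pair_L1_right[OF 1] unfolding fourier_coeff_eq_pair pair_L1_eq
    by (simp add: mult.assoc)
  \<comment> \<open>Rotation produces the factor w^m; it may be exchanged for w^k because the
    coefficient vanishes unless m = k.\<close>
  show "fourier_coeff (\<lambda>z. (w * z) powi m) k = w powi k * fourier_coeff (\<lambda>z. z powi m) k" for m
  proof -
    have "fourier_coeff (\<lambda>z. (w * z) powi m) k = w powi m * fourier_coeff (\<lambda>z. z powi m) k"
      unfolding power_int_mult_distrib
      by (rule CT_dual_cmult[OF CT_dual_fourier_coeff continuous_on_circle_powi])
    then show ?thesis by (simp add: fourier_coeff_powi)
  qed
qed

section \<open>Completeness of L1 and density of continuous functions\<close>

text \<open>Riesz-Fischer for a geometric series: integrating the sum of the norms termwise shows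
  absolute convergence almost everywhere, and the bound is the geometric tail from m on, (1/3)^m *
  (3/2).\<close>

lemma L1_complete:
  assumes \<xi>: "\<And>j::nat. L1_T (\<xi> j) \<and> L1_norm (\<xi> j) \<le> (1/3)^j"
  shows "\<exists>x. L1_T x \<and> (\<forall>m. L1_norm (\<lambda>z. x z - (\<Sum>j<m. \<xi> j z)) \<le> (1/3)^m * (3/2))"
proof -
  define h where "h j t = \<xi> j (cis t)" for j t
  have int: "integrable period_measure (h j)" for j
    using \<xi>[of j] by (simp add: L1_T_iff h_def[abs_def])
  have le: "(\<integral>t. norm (h j t) \<partial>period_measure) \<le> 2 * pi * (1/3)^j" for j
    using \<xi>[of j] by (simp add: L1_norm_eq h_def field_simps)
  have geo: "summable (\<lambda>j. 2 * pi * (1/3)^j)"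
    by (intro summable_mult summable_geometric) auto
  have sums: "summable (\<lambda>j. \<integral>t. norm (h j t) \<partial>period_measure)"
    by (rule summable_comparison_test'[OF geo]) (use le in auto)
  have AE: "AE t in period_measure. summable (\<lambda>j. norm (h j t))"
  proof -
    have meas: "(\<lambda>t. \<Sum>j. ennreal (norm (h j t))) \<in> borel_measurable period_measure"
      using int by measurable
    have "(\<integral>\<^sup>+t. (\<Sum>j. ennreal (norm (h j t))) \<partial>period_measure) = (\<Sum>j. \<integral>\<^sup>+t. ennreal (norm (h j t)) \<partial>period_measure)"
      using int by (intro nn_integral_suminf) auto
    also have "\<dots> = (\<Sum>j. ennreal (\<integral>t. norm (h j t) \<partial>period_measure))"
      using int by (intro suminf_cong nn_integral_eq_integral) auto
    also have "\<dots> \<noteq> \<infinity>" using sums by (simp add: ennreal_suminf_neq_top)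
    finally have "AE t in period_measure. (\<Sum>j. ennreal (norm (h j t))) \<noteq> \<infinity>"
      by (rule nn_integral_noteq_infinite[OF meas])
    then show ?thesis
      by eventually_elim (rule summable_suminf_not_top, auto)
  qed
  \<comment> \<open>Where the series diverges \<open>suminf\<close> is an unspecified value; the
    parameters t concerned form a null set.\<close>
  define x where "x z = (\<Sum>j. \<xi> j z)" for z
  have x: "L1_T x"
    using integrable_suminf[OF int AE sums] by (simp add: L1_T_iff x_def h_def)
  have "L1_norm (\<lambda>z. x z - (\<Sum>j<m. \<xi> j z)) \<le> (1/3)^m * (3/2)" for m
  proof -
    have AE': "AE t in period_measure. summable (\<lambda>j. norm (h (j + m) t))"
      using AE by eventually_elim (simp add: summable_iff_shift[of "\<lambda>j. norm (h j _)"])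
    have sums': "summable (\<lambda>j. \<integral>t. norm (h (j + m) t) \<partial>period_measure)"
      using sums by (simp add: summable_iff_shift[of "\<lambda>j. \<integral>t. norm (h j t) \<partial>period_measure"])
    note tail = integrable_suminf[of period_measure "\<lambda>j t. norm (h (j + m) t)"]
      integral_suminf[of period_measure "\<lambda>j t. norm (h (j + m) t)"]
    have "(\<integral>t. norm (x (cis t) - (\<Sum>j<m. h j t)) \<partial>period_measure)
        \<le> (\<integral>t. (\<Sum>j. norm (h (j + m) t)) \<partial>period_measure)"
    proof (rule integral_mono_AE)
      show "integrable period_measure (\<lambda>t. norm (x (cis t) - (\<Sum>j<m. h j t)))"
        using x int by (simp add: L1_T_iff)
      show "integrable period_measure (\<lambda>t. \<Sum>j. norm (h (j + m) t))"
        using int AE' sums' by (intro tail) auto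
      show "AE t in period_measure. norm (x (cis t) - (\<Sum>j<m. h j t)) \<le> (\<Sum>j. norm (h (j + m) t))"
        using AE AE'
      proof eventually_elim
        case (elim t)
        have "x (cis t) = (\<Sum>j. h (j + m) t) + (\<Sum>j<m. h j t)"
          unfolding x_def h_def[symmetric]
          by (rule suminf_split_initial_segment[OF summable_norm_cancel[OF elim(1)]])
        then show ?case using summable_norm[OF elim(2)] by simp
      qed
    qed
    also have "\<dots> = (\<Sum>j. \<integral>t. norm (h (j + m) t) \<partial>period_measure)"
      using int AE' sums' by (intro tail) auto
    also have "\<dots> \<le> (\<Sum>j. (2 * pi * (1/3)^m) * (1/3)^j)"
      using le[of "_ + m"] by (intro suminf_le sums' summable_mult summable_geometric)
        (auto simp: power_add mult_ac)
    also have "\<dots> = 2 * pi * ((1/3)^m * (3/2))"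
      by (subst suminf_mult) (auto simp: suminf_geometric)
    finally show ?thesis by (simp add: L1_norm_eq h_def field_simps)
  qed
  with x show ?thesis by blast
qed

section \<open>Density of continuous functions in L1\<close>

lemma cis_eq_cis_iff:
  assumes "s \<in> {0<..<2*pi}" "t \<in> {0..2*pi}" "cis s = cis t"
  shows "s = t"
proof -
  from assms(3) obtain n :: int where "\<i> * of_real s = \<i> * of_real t + of_real (of_int (2 * n) * pi) * \<i>"
    unfolding cis_conv_exp exp_eq by auto
  then have "\<i> * of_real s = \<i> * of_real (t + of_int (2 * n) * pi)"
    by (simp add: algebra_simps)
  then have st: "s = t + of_int (2 * n) * pi"
    by (metis complex_i_not_zero mult_left_cancel of_real_eq_iff)
  \<comment> \<open>Strict because s is interior to the interval; with both parameters at endpoints,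
    0 and 2*pi would have the same image.\<close>
  have "\<bar>of_int (2 * n) * pi\<bar> < 2 * pi" using assms st by auto
  then have "\<bar>real_of_int (2 * n)\<bar> < 2" by (simp add: abs_mult)
  then have "n = 0" by linarith
  with st show ?thesis by simp
qed

lemma indicator_compact_approx:
  assumes K: "compact K" "K \<subseteq> {0<..<2*pi}" and e: "e > 0"
  shows "\<exists>f. continuous_on circle f \<and> (\<integral>t. norm (indicator K t - f (cis t) :: complex) \<partial>period_measure) < e"
proof (cases "K = {}")
  \<comment> \<open>\<open>infdist\<close> to the empty set is 0, which would make every bump
    constantly 1.\<close>
  case True
  then show ?thesis using e by (intro exI[of _ "\<lambda>_. 0"]) auto
next
  case False
  define L where "L = cis ` K"
  have L: "closed L" "L \<noteq> {}"
    using K False unfolding L_def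
    by (auto intro!: compact_imp_closed compact_continuous_image continuous_intros)
  define f where "f m z = complex_of_real (max 0 (1 - real m * infdist z L))" for m z
  have f: "continuous_on circle (f m)" for m
    unfolding f_def by (intro continuous_intros)
  have int: "integrable period_measure (\<lambda>t. f m (cis t))" for m
    using continuous_imp_L1_T[OF f] by (simp add: L1_T_iff)
  have Km: "K \<in> sets borel" using K by (simp add: compact_imp_closed borel_closed)
  have Kmeas: "(\<lambda>t. indicator K t :: complex) \<in> borel_measurable period_measure"
    using Km by (intro measurable_restrict_space1) auto
  have "(\<lambda>m. \<integral>t. norm (indicator K t - f m (cis t)) \<partial>period_measure) \<longlonglongrightarrow> (\<integral>t. 0 \<partial>period_measure)"
  proof (rule integral_dominated_convergence[where w = "\<lambda>_. 2"])
    show "integrable period_measure (\<lambda>_. 2 :: real)"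
      by (rule finite_measure.integrable_const[OF finite_measure_period_measure])
    show "(\<lambda>t. norm (indicator K t - f m (cis t))) \<in> borel_measurable period_measure" for m
      using Kmeas int[of m] by measurable
    show "AE t in period_measure. norm (norm (indicator K t - f m (cis t))) \<le> 2" for m
    proof (rule AE_I2)
      fix t
      have "norm (f m (cis t)) \<le> 1" by (auto simp: f_def infdist_nonneg max_def)
      then show "norm (norm (indicator K t - f m (cis t))) \<le> 2"
        using norm_triangle_ineq4[of "indicator K t" "f m (cis t)"]
        by (auto simp: indicator_def split: if_splits)
    qed
    show "AE t in period_measure. (\<lambda>m. norm (indicator K t - f m (cis t))) \<longlonglongrightarrow> 0"
    proof (rule AE_I2)
      fix t assume "t \<in> space period_measure"
      then have t: "t \<in> {0..2*pi}" by (simp add: space_restrict_space)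
      show "(\<lambda>m. norm (indicator K t - f m (cis t))) \<longlonglongrightarrow> 0"
      proof (cases "t \<in> K")
        case True
        then have "infdist (cis t) L = 0" by (simp add: L_def)
        then show ?thesis using True by (simp add: f_def)
      next
        case False
        have "cis t \<notin> L"
          using cis_eq_cis_iff[of _ t] t K(2) False unfolding L_def by (metis imageE subsetD)
        then have pos: "infdist (cis t) L > 0"
          using L by (simp add: in_closed_iff_infdist_zero order_less_le infdist_nonneg)
        obtain M :: nat where M: "real M * infdist (cis t) L > 1"
          using ex_less_of_nat_mult[OF pos] by blast
        have "f m (cis t) = 0" if "m \<ge> M" for m
        proof -
          have "real M * infdist (cis t) L \<le> real m * infdist (cis t) L"
            using that pos by (intro mult_right_mono) auto
          then show ?thesis using M by (simp add: f_def)
        qed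
        then have "\<forall>\<^sub>F m in sequentially. norm (indicator K t - f m (cis t)) = 0"
          using False by (auto simp: eventually_sequentially)
        then show ?thesis by (rule tendsto_eventually)
      qed
    qed
  qed simp_all
  then have "\<forall>\<^sub>F m in sequentially. (\<integral>t. norm (indicator K t - f m (cis t)) \<partial>period_measure) < e"
    using e by (intro order_tendstoD) auto
  then show ?thesis using f eventually_happens' sequentially_bot by blast
qed

lemma period_integral_norm_diff_triangle:
  assumes "integrable period_measure h" "integrable period_measure s" "continuous_on circle f"
  shows "(\<integral>t. norm (h t - f (cis t)) \<partial>period_measure) \<le>
    (\<integral>t. norm (h t - s t) \<partial>period_measure) + (\<integral>t. norm (s t - f (cis t) :: complex) \<partial>period_measure)"
proof -
  have f: "integrable period_measure (\<lambda>t. f (cis t))"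
    using continuous_imp_L1_T[OF assms(3)] by (simp add: L1_T_iff)
  have "(\<integral>t. norm (h t - f (cis t)) \<partial>period_measure) \<le>
      (\<integral>t. norm (h t - s t) + norm (s t - f (cis t)) \<partial>period_measure)"
    using assms f by (intro integral_mono Bochner_Integration.integrable_add integrable_norm
        Bochner_Integration.integrable_diff norm_diff_triangle_le[OF order_refl order_refl])
  also have "\<dots> = (\<integral>t. norm (h t - s t) \<partial>period_measure) + (\<integral>t. norm (s t - f (cis t)) \<partial>period_measure)"
    using assms f by (intro Bochner_Integration.integral_add) auto
  finally show ?thesis .
qed

text \<open>Deleting the endpoints costs a null set and puts K inside the open interval, where the
  bump functions approximate its indicator.\<close>

lemma period_measure_inner_compact:
  assumes A: "A \<in> sets period_measure" and e: "e > 0"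
  shows "\<exists>K. compact K \<and> K \<subseteq> A \<inter> {0<..<2*pi} \<and> measure period_measure (A - K) < e"
proof -
  have A': "A \<in> sets borel" "A \<subseteq> {0..2*pi}"
    using A by (auto simp: sets_restrict_space)
  let ?A = "A \<inter> {0<..<2*pi}"
  have "?A \<in> sets lebesgue" using A' by auto
  then obtain K where K: "closed K" "K \<subseteq> ?A" "emeasure lebesgue (?A - K) < ennreal e"
    using sets_lebesgue_inner_closed[OF _ e] by metis
  have cK: "compact K"
    using K by (meson Int_lower2 bounded_closed_interval bounded_subset compact_eq_bounded_closed
        greaterThanLessThan_subseteq_atLeastAtMost_iff order_refl subset_trans)
  have Kb: "K \<in> sets borel" using K by simp
  have "emeasure period_measure (A - K) = emeasure lborel (A - K)"
    using A' by (subst emeasure_restrict_space) auto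
  also have "\<dots> \<le> emeasure lborel ((?A - K) \<union> {0, 2*pi})"
    using A' Kb by (intro emeasure_mono) (auto simp: less_le)
  also have "\<dots> = emeasure lborel (?A - K)"
    by (rule emeasure_Un_null_set) (use A' Kb in \<open>auto intro!: finite_imp_null_set_lborel\<close>)
  also have "\<dots> < ennreal e" using K A' Kb by simp
  finally have "measure period_measure (A - K) < e"
    using e by (simp add: finite_measure.emeasure_eq_measure[OF finite_measure_period_measure] ennreal_less_iff)
  with K cK show ?thesis by blast
qed

lemma continuous_dense_integrable:
  fixes h :: "real \<Rightarrow> complex"
  assumes "integrable period_measure h" and "e > 0"
  shows "\<exists>f. continuous_on circle f \<and> (\<integral>t. norm (h t - f (cis t)) \<partial>period_measure) < e"
  using assms
proof (induction arbitrary: e rule: integrable_induct)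
  case (base A c)
  \<comment> \<open>One d is spent on the approximation of A by K and one on that of K by f, both
    scaled by |c|; the added 1 covers c = 0 and makes the final inequality strict.\<close>
  define d where "d = e / (2 * (norm c + 1))"
  have d: "d > 0" using base(3) by (auto simp: d_def intro!: divide_pos_pos add_nonneg_pos)
  obtain K where K: "compact K" "K \<subseteq> A \<inter> {0<..<2*pi}" "measure period_measure (A - K) < d"
    using period_measure_inner_compact[OF base(1) d] by blast
  then obtain f :: "complex \<Rightarrow> complex" where f: "continuous_on circle f"
    "(\<integral>t. norm (indicator K t - f (cis t)) \<partial>period_measure) < d"
    using indicator_compact_approx[of K d] d by auto
  have Ks: "K \<in> sets period_measure"
    using K by (auto simp: sets_restrict_space_iff compact_imp_closed less_imp_le)
  interpret finite_measure period_measure by (rule finite_measure_period_measure)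
  have int: "integrable period_measure (\<lambda>t. indicator B t :: complex)" if "B \<in> sets period_measure" for B
  proof -
    have "integrable period_measure (\<lambda>t. indicator B t *\<^sub>R (1::complex))"
      using that by (intro integrable_scaleR_left) (simp add: less_top[symmetric])
    then show ?thesis by (simp add: scaleR_conv_of_real of_real_indicator)
  qed
  have AK: "(A - K) \<inter> {0..2*pi} = A - K"
    using sets.sets_into_space[OF base(1)] by auto
  have "(\<integral>t. norm (indicator A t - indicator K t :: complex) \<partial>period_measure) =
      (\<integral>t. indicator (A - K) t \<partial>period_measure)"
    using K(2) by (intro Bochner_Integration.integral_cong) (auto simp: indicator_def)
  also have "\<dots> = measure period_measure (A - K)"
    by (simp add: AK)
  finally have less: "(\<integral>t. norm (indicator A t - f (cis t)) \<partial>period_measure) < d + d"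
    using period_integral_norm_diff_triangle[OF int[OF base(1)] int[OF Ks] f(1)] f(2) K(3) by linarith
  have eq: "norm (indicator A t *\<^sub>R c - c * f (cis t)) = norm c * norm (indicator A t - f (cis t))" for t
    by (cases "t \<in> A") (auto simp: norm_mult right_diff_distrib simp flip: norm_mult)
  from less have "norm c * (\<integral>t. norm (indicator A t - f (cis t)) \<partial>period_measure) \<le> norm c * (d + d)"
    by (intro mult_left_mono) auto
  also have "\<dots> < (norm c + 1) * (d + d)" using d by (intro mult_strict_right_mono) auto
  also have "\<dots> = e" by (simp add: d_def field_simps add_nonneg_eq_0_iff)
  finally have "(\<integral>t. norm (indicator A t *\<^sub>R c - c * f (cis t)) \<partial>period_measure) < e"
    by (simp add: eq)
  then show ?case using f(1) by (intro exI[of _ "\<lambda>z. c * f z"]) (auto intro!: continuous_intros)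
next
  case (add g h)
  then have "e/2 > 0" by simp
  then obtain p q where pq: "continuous_on circle p" "(\<integral>t. norm (g t - p (cis t)) \<partial>period_measure) < e/2"
    "continuous_on circle q" "(\<integral>t. norm (h t - q (cis t)) \<partial>period_measure) < e/2"
    using add.IH by meson
  have p: "integrable period_measure (\<lambda>t. p (cis t))" and q: "integrable period_measure (\<lambda>t. q (cis t))"
    using continuous_imp_L1_T pq by (auto simp: L1_T_iff)
  have "(\<integral>t. norm (g t + h t - (p (cis t) + q (cis t))) \<partial>period_measure) \<le>
      (\<integral>t. norm (g t - p (cis t)) + norm (h t - q (cis t)) \<partial>period_measure)"
    using add.hyps p q by (intro integral_mono) (auto simp: norm_diff_triangle_ineq)
  also have "\<dots> = (\<integral>t. norm (g t - p (cis t)) \<partial>period_measure) + (\<integral>t. norm (h t - q (cis t)) \<partial>period_measure)"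
    using add.hyps p q by (intro Bochner_Integration.integral_add) auto
  also have "\<dots> < e" using pq by simp
  finally show ?case using pq by (intro exI[of _ "\<lambda>z. p z + q z"]) (auto intro!: continuous_intros)
next
  case (lim h s)
  have "(\<lambda>i. \<integral>t. norm (h t - s i t) \<partial>period_measure) \<longlonglongrightarrow> (\<integral>t. 0 \<partial>period_measure)"
  \<comment> \<open>The simple approximants of the induction satisfy |s i| \<le> 2 * |h|, whence the
    factor 1 + 2.\<close>
  proof (rule integral_dominated_convergence[where w = "\<lambda>t. 3 * norm (h t)"])
    show "integrable period_measure (\<lambda>t. 3 * norm (h t))" using lim.hyps by simp
    show "(\<lambda>t. norm (h t - s i t)) \<in> borel_measurable period_measure" for i
      using lim.hyps by measurable
    show "AE t in period_measure. norm (norm (h t - s i t)) \<le> 3 * norm (h t)" for i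
    proof (rule AE_I2)
      fix t assume "t \<in> space period_measure"
      then show "norm (norm (h t - s i t)) \<le> 3 * norm (h t)"
        using lim.hyps(3)[of t i] norm_triangle_ineq4[of "h t" "s i t"] by simp
    qed
    show "AE t in period_measure. (\<lambda>i. norm (h t - s i t)) \<longlonglongrightarrow> 0"
    proof (rule AE_I2)
      fix t assume "t \<in> space period_measure"
      from lim.hyps(2)[OF this] show "(\<lambda>i. norm (h t - s i t)) \<longlonglongrightarrow> 0"
        using tendsto_norm[OF tendsto_diff[OF tendsto_const[of "h t"]]] by fastforce
    qed
  qed simp_all
  then have "\<forall>\<^sub>F i in sequentially. (\<integral>t. norm (h t - s i t) \<partial>period_measure) < e/2"
    using lim.prems by (intro order_tendstoD) auto
  then obtain i where i: "(\<integral>t. norm (h t - s i t) \<partial>period_measure) < e/2"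
    using eventually_happens' sequentially_bot by blast
  obtain f where f: "continuous_on circle f" "(\<integral>t. norm (s i t - f (cis t)) \<partial>period_measure) < e/2"
    using lim.IH[of "e/2" i] lim.prems by auto
  have "(\<integral>t. norm (h t - f (cis t)) \<partial>period_measure) < e"
    using period_integral_norm_diff_triangle[OF lim.hyps(4,1) f(1), of i] i f(2) by linarith
  with f show ?case by blast
qed

lemma continuous_dense_L1:
  assumes "L1_T g" "e > 0"
  obtains f where "continuous_on circle f" "L1_norm (\<lambda>z. g z - f z) < e"
proof -
  have "2 * pi * e > 0" using assms by simp
  with continuous_dense_integrable[of "\<lambda>t. g (cis t)"] assms(1)
  obtain f where "continuous_on circle f" "(\<integral>t. norm (g (cis t) - f (cis t)) \<partial>period_measure) < 2 * pi * e"
    unfolding L1_T_iff by blast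
  then show thesis using that by (simp add: L1_norm_eq field_simps)
qed

section \<open>Duality bounds and functionals given by measures\<close>

lemma L1_norm_cong: "(\<And>z. z \<in> circle \<Longrightarrow> f z = g z) \<Longrightarrow> L1_norm f = L1_norm g"
  by (simp add: L1_norm_eq)

text \<open>Converse of Hoelder's inequality: as a functional on L1, a continuous F has its sup norm
  as norm. Continuous test functions already detect it, and the bound holds at every point, not just
  almost everywhere; this gives access to the value at 1.\<close>

lemma pair_L1_bound_imp_sup_bound:
  assumes F: "continuous_on circle F" and C: "C \<ge> 0"
    and bound: "\<And>g. continuous_on circle g \<Longrightarrow> norm (pair_L1 F g) \<le> C * L1_norm g"
    and z: "z \<in> circle"
  shows "norm (F z) \<le> C"
proof -
  define G where "G z = F (cnj z)" for z
  have G: "continuous_on circle G"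
    unfolding G_def by (rule continuous_on_circle_cnj[OF F])
  \<comment> \<open>Testing against \<open>cnj G (|G| - C)\<^sup>+\<close> forces \<open>|G| (|G| - C) (|G| - C)\<^sup>+\<close> to have integral at most 0.\<close>
  define w where "w z = max 0 (norm (G z) - C)" for z
  define g where "g z = cnj (G z) * of_real (w z)" for z
  define k where "k z = norm (G z) * (norm (G z) - C) * w z" for z
  have g: "continuous_on circle g" and k: "continuous_on circle k"
    unfolding g_def k_def w_def by (intro continuous_intros G)+
  have k_nonneg: "0 \<le> k z" for z by (auto simp: k_def w_def max_def)
  have w_nonneg: "0 \<le> w z" for z by (simp add: w_def)
  have kint: "set_integrable lborel {0..2*pi} (\<lambda>t. k (cis t))"
    by (intro borel_integrable_atLeastAtMost' continuous_on_subset[OF continuous_on_cis_comp[OF k]]) auto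
  have ng: "integrable period_measure (\<lambda>t. norm (G (cis t)) * w (cis t))"
    using integrable_norm[OF continuous_imp_L1_T[OF g, unfolded L1_T_iff]] w_nonneg
    by (simp add: g_def norm_mult)
  have kint': "integrable period_measure (\<lambda>t. k (cis t))"
    using kint by (simp add: set_integrable_def integrable_restrict_space)
  have "F (cnj (cis t)) * g (cis t) = of_real (k (cis t) + C * (norm (G (cis t)) * w (cis t)))" for t
  proof -
    have "F (cnj (cis t)) * g (cis t) = of_real ((norm (G (cis t)))\<^sup>2 * w (cis t))"
      by (simp add: g_def flip: G_def mult.assoc complex_norm_square)
    also have "(norm (G (cis t)))\<^sup>2 * w (cis t) = k (cis t) + C * (norm (G (cis t)) * w (cis t))"
      by (simp add: k_def power2_eq_square algebra_simps)
    finally show ?thesis .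
  qed
  then have "pair_L1 F g = (\<integral>t. complex_of_real (k (cis t) + C * (norm (G (cis t)) * w (cis t))) \<partial>period_measure) / (2*pi)"
    unfolding pair_L1_eq by simp
  also have "(\<integral>t. complex_of_real (k (cis t) + C * (norm (G (cis t)) * w (cis t))) \<partial>period_measure) =
     complex_of_real (\<integral>t. k (cis t) + C * (norm (G (cis t)) * w (cis t)) \<partial>period_measure)"
    by (rule integral_complex_of_real)
  also have "(\<integral>t. k (cis t) + C * (norm (G (cis t)) * w (cis t)) \<partial>period_measure) =
     (\<integral>t. k (cis t) \<partial>period_measure) + C * (\<integral>t. norm (G (cis t)) * w (cis t) \<partial>period_measure)"
    using kint' ng by simp
  also have "(\<integral>t. norm (G (cis t)) * w (cis t) \<partial>period_measure) = 2 * pi * L1_norm g"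
    using w_nonneg by (simp add: L1_norm_eq g_def norm_mult)
  finally have eq: "pair_L1 F g = of_real ((\<integral>t. k (cis t) \<partial>period_measure) / (2*pi) + C * L1_norm g)"
    by (simp add: field_simps)
  have "(\<integral>t. k (cis t) \<partial>period_measure) / (2*pi) + C * L1_norm g \<le> C * L1_norm g"
    using bound[OF g] unfolding eq norm_of_real by linarith
  then have "(\<integral>t. k (cis t) \<partial>period_measure) \<le> 0" by (simp add: field_simps)
  then have "(\<integral>t. k (cis t) \<partial>period_measure) = 0"
    using k_nonneg by (intro antisym integral_nonneg) auto
  \<comment> \<open>On a closed interval a nonnegative continuous function with integral 0 vanishes
    everywhere; the gauge integral has this fact in pointwise form.\<close>
  then have "integral {0..2*pi} (\<lambda>t. k (cis t)) = 0"
    using set_borel_integral_eq_integral(2)[OF kint] by (simp add: set_integral_period)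
  then have k0: "k (cis t) = 0" if "t \<in> {0..2*pi}" for t
    using integral_eq_0_iff[of 0 "2*pi" "\<lambda>t. k (cis t)"] k_nonneg that
      continuous_on_subset[OF continuous_on_cis_comp[OF k], of "{0..2*pi}"] by auto
  obtain t where "t \<in> {0..2*pi}" "cnj z = cis t"
    using circle_cisE circle_cnj[OF z] by metis
  then have "k (cnj z) = 0" using k0 by simp
  then show ?thesis using C by (auto simp: k_def w_def G_def max_def split: if_splits)
qed

text \<open>The ideal test function cnj h / |h| breaks down at zeros of h. With max |h| e as
  denominator it is continuous and of modulus at most 1, and the loss is at most e since |h|^2 / max
  |h| e \<ge> |h| - e.\<close>

lemma L1_norm_le_dual:
  assumes h: "continuous_on circle h"
    and bound: "\<And>f. continuous_on circle f \<Longrightarrow> (\<And>z. z \<in> circle \<Longrightarrow> norm (f z) \<le> 1) \<Longrightarrow>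
      norm (pair_L1 f h) \<le> C"
  shows "L1_norm h \<le> C"
proof (rule field_le_epsilon)
  fix e :: real assume e: "e > 0"
  define u where "u z = cnj (h z) / of_real (max (norm (h z)) e)" for z
  define f where "f z = u (cnj z)" for z
  have "continuous_on circle u"
    unfolding u_def using e by (intro continuous_intros h) auto
  then have f: "continuous_on circle f"
    unfolding f_def by (rule continuous_on_circle_cnj)
  have f1: "norm (f z) \<le> 1" for z
    using e by (auto simp: f_def u_def norm_divide divide_simps)
  define k where "k z = (norm (h z))\<^sup>2 / max (norm (h z)) e" for z
  have k: "continuous_on circle k" unfolding k_def using e by (intro continuous_intros h) auto
  have kint: "integrable period_measure (\<lambda>t. k (cis t))"
    using borel_integrable_atLeastAtMost'[OF continuous_on_subset[OF continuous_on_cis_comp[OF k]], of 0 "2*pi"]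
    by (simp add: set_integrable_def integrable_restrict_space)
  have hint: "integrable period_measure (\<lambda>t. norm (h (cis t)))"
    using continuous_imp_L1_T[OF h] by (simp add: L1_T_iff)
  have cint: "integrable period_measure (\<lambda>t. c)" for c :: real
    by (rule finite_measure.integrable_const[OF finite_measure_period_measure])
  have "f (cnj (cis t)) * h (cis t) = of_real (k (cis t))" for t
    unfolding f_def u_def k_def of_real_divide complex_norm_square by (simp add: mult.commute)
  then have eq: "pair_L1 f h = of_real ((\<integral>t. k (cis t) \<partial>period_measure) / (2*pi))"
    unfolding pair_L1_eq by simp
  have "norm (h z) - e \<le> k z" for z
  proof (cases "norm (h z) \<le> e")
    case True
    moreover have "0 \<le> k z" using e by (simp add: k_def)
    ultimately show ?thesis by linarith
  next
    case False
    then show ?thesis using e by (simp add: k_def max_def power2_eq_square)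
  qed
  then have "(\<integral>t. norm (h (cis t)) - e \<partial>period_measure) \<le> (\<integral>t. k (cis t) \<partial>period_measure)"
    using hint kint cint by (intro integral_mono) auto
  also have "(\<integral>t. norm (h (cis t)) - e \<partial>period_measure) = (\<integral>t. norm (h (cis t)) \<partial>period_measure) - 2 * pi * e"
    by (subst Bochner_Integration.integral_diff[OF hint cint]) (simp only: integral_period_const)
  finally have "((\<integral>t. norm (h (cis t)) \<partial>period_measure) - 2 * pi * e) / (2*pi) \<le>
      (\<integral>t. k (cis t) \<partial>period_measure) / (2*pi)"
    by (rule divide_right_mono) simp
  then have "L1_norm h - e \<le> (\<integral>t. k (cis t) \<partial>period_measure) / (2*pi)"
    by (simp add: L1_norm_eq diff_divide_distrib)
  also have "\<dots> \<le> norm (pair_L1 f h)" unfolding eq norm_of_real by linarith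
  also have "\<dots> \<le> C" by (rule bound[OF f f1])
  finally show "L1_norm h \<le> C + e" by simp
qed

section \<open>Complex measures as functionals on C(T)\<close>

lemma CT_dual_lincomb:
  assumes "CT_dual \<phi>" "CT_dual \<psi>"
  shows "CT_dual (\<lambda>f. \<phi> f + c * \<psi> f)"
proof -
  obtain C where C: "C > 0" "\<And>f B. continuous_on circle f \<Longrightarrow>
    (\<And>z. z \<in> circle \<Longrightarrow> norm (f z) \<le> B) \<Longrightarrow> norm (\<phi> f) \<le> C * B"
    using CT_dual_bounded[OF assms(1)] by blast
  obtain D where D: "D > 0" "\<And>f B. continuous_on circle f \<Longrightarrow>
    (\<And>z. z \<in> circle \<Longrightarrow> norm (f z) \<le> B) \<Longrightarrow> norm (\<psi> f) \<le> D * B"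
    using CT_dual_bounded[OF assms(2)] by blast
  show ?thesis
    unfolding CT_dual_def
  proof (intro conjI allI impI exI[of _ "C + norm c * D"])
    fix g h :: "complex \<Rightarrow> complex" and d :: complex and B :: real
    assume g: "continuous_on circle g"
    show "\<phi> (\<lambda>z. d * g z) + c * \<psi> (\<lambda>z. d * g z) = d * (\<phi> g + c * \<psi> g)"
      using CT_dual_cmult[OF assms(1) g, of d] CT_dual_cmult[OF assms(2) g, of d]
      by (simp add: algebra_simps)
    {
      assume h: "continuous_on circle h"
      show "\<phi> (\<lambda>z. g z + h z) + c * \<psi> (\<lambda>z. g z + h z) = \<phi> g + c * \<psi> g + (\<phi> h + c * \<psi> h)"
        using CT_dual_add[OF assms(1) g h] CT_dual_add[OF assms(2) g h] by (simp add: algebra_simps)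
      assume "\<forall>z\<in>circle. g z = h z"
      then show "\<phi> g + c * \<psi> g = \<phi> h + c * \<psi> h"
        using CT_dual_cong[OF assms(1) g h] CT_dual_cong[OF assms(2) g h] by simp
    }
    {
      assume B: "\<forall>z\<in>circle. norm (g z) \<le> B"
      have "norm (\<phi> g + c * \<psi> g) \<le> norm (\<phi> g) + norm c * norm (\<psi> g)"
        by (metis norm_mult norm_triangle_ineq)
      also have "\<dots> \<le> C * B + norm c * (D * B)"
        using C(2)[OF g] D(2)[OF g] B by (intro add_mono mult_left_mono) auto
      finally show "norm (\<phi> g + c * \<psi> g) \<le> (C + norm c * D) * B" by (simp add: algebra_simps)
    }
  qed
qed

lemma CT_dual_integral:
  assumes M: "fin_borel_T M"
  shows "CT_dual (\<lambda>f. \<integral>z. f (cnj z) \<partial>M)"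
proof -
  interpret finite_measure M using M by (simp add: fin_borel_T_def)
  have sM: "sets M = sets (restrict_space borel circle)" using M by (simp add: fin_borel_T_def)
  have sp: "space M = circle" using sets_eq_imp_space_eq[OF sM] by (simp add: space_restrict_space)
  have int: "integrable M (\<lambda>z. f (cnj z))" if f: "continuous_on circle f" for f :: "complex \<Rightarrow> complex"
  proof -
    obtain B where "\<And>z. z \<in> circle \<Longrightarrow> norm (f z) \<le> B"
      using continuous_on_circle_bounded[OF f] by blast
    moreover have "(\<lambda>z. f (cnj z)) \<in> borel_measurable M"
      using borel_measurable_continuous_on_restrict[OF continuous_on_circle_cnj[OF f]]
      by (simp add: measurable_cong_sets[OF sM refl])
    ultimately show ?thesis
      by (intro integrable_const_bound[where B = B] AE_I2) (auto simp: sp circle_cnj)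
  qed
  show ?thesis
    unfolding CT_dual_def
  proof (intro conjI allI impI exI[of _ "measure M (space M)"])
    fix g h :: "complex \<Rightarrow> complex" and d :: complex and B :: real
    assume g: "continuous_on circle g"
    show "(\<integral>z. d * g (cnj z) \<partial>M) = d * (\<integral>z. g (cnj z) \<partial>M)" by simp
    {
      assume h: "continuous_on circle h"
      show "(\<integral>z. g (cnj z) + h (cnj z) \<partial>M) = (\<integral>z. g (cnj z) \<partial>M) + (\<integral>z. h (cnj z) \<partial>M)"
        using int[OF g] int[OF h] by simp
      assume "\<forall>z\<in>circle. g z = h z"
      then show "(\<integral>z. g (cnj z) \<partial>M) = (\<integral>z. h (cnj z) \<partial>M)"
        by (intro Bochner_Integration.integral_cong) (auto simp: sp circle_cnj)
    }
    {
      assume "\<forall>z\<in>circle. norm (g z) \<le> B"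
      then have le: "(\<integral>z. norm (g (cnj z)) \<partial>M) \<le> (\<integral>z. B \<partial>M)"
        using int[OF g] by (intro integral_mono) (auto simp: sp circle_cnj)
      show "norm (\<integral>z. g (cnj z) \<partial>M) \<le> measure M (space M) * B"
        using order_trans[OF integral_norm_bound le] by simp
    }
  qed
qed

text \<open>The coefficients of a measure and its pairings are all values of this one functional, so
  the choice of the quadruple representing the measure never matters.\<close>

lemma CT_dual_pair_meas:
  assumes "cmeasure_T \<mu>"
  shows "CT_dual (\<lambda>f. pair_meas f \<mu>)"
proof -
  obtain M1 M2 M3 M4 where \<mu>: "\<mu> = (M1, M2, M3, M4)" by (cases \<mu>)
  then have M: "fin_borel_T M1" "fin_borel_T M2" "fin_borel_T M3" "fin_borel_T M4"
    using assms by (auto simp: cmeasure_T_def)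
  have "CT_dual (\<lambda>f. ((\<integral>z. f (cnj z) \<partial>M1) + (-1) * (\<integral>z. f (cnj z) \<partial>M2)) +
      \<i> * ((\<integral>z. f (cnj z) \<partial>M3) + (-1) * (\<integral>z. f (cnj z) \<partial>M4)))"
    by (intro CT_dual_lincomb CT_dual_integral M)
  then show ?thesis by (simp add: pair_meas_def cint_def \<mu>)
qed

lemma meas_coeff_eq_pair: "meas_coeff \<mu> = (\<lambda>k. pair_meas (\<lambda>z. z powi k) \<mu>)"
  by (simp add: meas_coeff_def pair_meas_def fun_eq_iff)

text \<open>The point mass at 1 is fixed by the reflection in the pairing. It is the image of the
  counting measure on {1}, with null measures as the other components.\<close>

lemma dirac_cmeasure:
  obtains \<mu> where "cmeasure_T \<mu>" "\<And>f. continuous_on circle f \<Longrightarrow> pair_meas f \<mu> = f 1"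
proof -
  let ?S = "restrict_space borel circle :: complex measure"
  let ?d = "distr (count_space {1}) ?S (\<lambda>z. z)" and ?n = "null_measure ?S"
  have id: "(\<lambda>z. z) \<in> measurable (count_space {1}) ?S"
    by (simp add: space_restrict_space)
  have "finite_measure ?d"
    by (intro finite_measure.finite_measure_distr[OF _ id] finite_measure_count_space) simp
  then have d: "fin_borel_T ?d" by (simp add: fin_borel_T_def)
  have n: "fin_borel_T ?n"
    unfolding fin_borel_T_def by (auto intro!: finite_measureI)
  have "(\<integral>z. f (cnj z) \<partial>?d) = f 1" if f: "continuous_on circle f" for f :: "complex \<Rightarrow> complex"
    using integral_distr[OF id borel_measurable_continuous_on_restrict[OF continuous_on_circle_cnj[OF f]]]
    by (simp add: lebesgue_integral_count_space_finite)
  then show thesis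
    using d n by (intro that[of "(?d, ?n, ?n, ?n)"]) (auto simp: cmeasure_T_def pair_meas_def cint_def)
qed

section \<open>Multiplier operators\<close>

abbreviation (input) mult_op :: "(nat \<Rightarrow> int \<Rightarrow> complex) \<Rightarrow> nat \<Rightarrow> (complex \<Rightarrow> complex) \<Rightarrow> complex \<Rightarrow> complex" where
  "mult_op a n f \<equiv> mult_series a n (fourier_coeff f)"

lemma summable_mult_bounded:
  fixes b d :: "int \<Rightarrow> complex"
  assumes b: "(\<lambda>k. norm (b k)) summable_on UNIV" and d: "\<And>k. norm (d k) \<le> B"
  shows "(\<lambda>k. norm (b k * d k)) summable_on UNIV"
proof (rule Infinite_Sum.abs_summable_on_comparison_test')
  show "(\<lambda>k. norm (b k) * B) summable_on UNIV"
    using b by (rule summable_on_cmult_left)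
  show "norm (b k * d k) \<le> norm (b k) * B" for k
    using mult_left_mono[OF d[of k] norm_ge_zero[of "b k"]] by (simp add: norm_mult)
qed

lemma mult_op_powi: "mult_op a n (\<lambda>z. z powi m) z = a n m * z powi m"
proof -
  have "mult_op a n (\<lambda>z. z powi m) z =
      (\<Sum>\<^sub>\<infinity>k\<in>{m}. a n k * (if m = k then 1 else 0) * z powi k)"
    unfolding mult_series_def fourier_coeff_powi by (rule infsum_cong_neutral) auto
  then show ?thesis by simp
qed

text \<open>T_n commutes with rotations; hence control of the single functional f -> T_n f (1) is
  control of T_n f at every point of the circle.\<close>

lemma mult_op_rotate:
  "continuous_on circle f \<Longrightarrow> w \<in> circle \<Longrightarrow> mult_op a n (\<lambda>z. f (w * z)) 1 = mult_op a n f w"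
  unfolding mult_series_def by (intro infsum_cong, subst fourier_coeff_rotate) (auto simp: mult_ac)

context
  fixes a :: "nat \<Rightarrow> int \<Rightarrow> complex"
  assumes summ: "\<And>n. (\<lambda>k. norm (a n k)) summable_on UNIV"
begin

lemma summable_mult_fourier: "L1_T g \<Longrightarrow> (\<lambda>k. norm (a n k * fourier_coeff g k)) summable_on UNIV"
  by (rule summable_mult_bounded[OF summ fourier_coeff_bound])

lemma mult_op_continuous: "L1_T g \<Longrightarrow> continuous_on circle (mult_op a n g)"
  using continuous_on_powi_series[OF summable_mult_fourier] by (simp add: mult_series_def[abs_def])

lemma mult_op_lincomb:
  assumes f: "L1_T f" and g: "L1_T g" and z: "z \<in> circle"
  shows "mult_op a n (\<lambda>z. f z + c * g z) z = mult_op a n f z + c * mult_op a n g z"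
proof -
  have sumz: "(\<lambda>k. a n k * fourier_coeff h k * z powi k) summable_on UNIV" if "L1_T h" for h
  proof (rule abs_summable_summable)
    show "(\<lambda>k. norm (a n k * fourier_coeff h k * z powi k)) summable_on UNIV"
      using summable_mult_fourier[OF that, of n] by (simp add: norm_mult circle_powi z)
  qed
  have "fourier_coeff (\<lambda>z. f z + c * g z) k = fourier_coeff f k + c * fourier_coeff g k" for k
    unfolding fourier_coeff_eq_pair by (rule pair_L1_add_right[OF continuous_on_circle_powi f g])
  then have "mult_op a n (\<lambda>z. f z + c * g z) z =
      (\<Sum>\<^sub>\<infinity>k. a n k * fourier_coeff f k * z powi k + c * (a n k * fourier_coeff g k * z powi k))"
    by (simp add: mult_series_def algebra_simps)
  also have "\<dots> = mult_op a n f z + c * mult_op a n g z"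
    by (simp add: mult_series_def infsum_add sumz[OF f] summable_on_cmult_right[OF sumz[OF g]]
        infsum_cmult_right sumz[OF g])
  finally show ?thesis .
qed

text \<open>A crude bound that depends on n; it provides the continuity of each single functional
  (\<open>B n\<close>) that uniform boundedness presupposes.\<close>

lemma mult_op_eval_bound:
  assumes g: "L1_T g" and z: "z \<in> circle"
  shows "norm (mult_op a n g z) \<le> (\<Sum>\<^sub>\<infinity>k. norm (a n k)) * L1_norm g"
proof -
  have "norm (mult_op a n g z) \<le> (\<Sum>\<^sub>\<infinity>k. norm (a n k * fourier_coeff g k * z powi k))"
    unfolding mult_series_def
    using summable_mult_fourier[OF g, of n] by (intro norm_infsum_bound) (simp add: norm_mult circle_powi z)
  also have "\<dots> \<le> (\<Sum>\<^sub>\<infinity>k. norm (a n k) * L1_norm g)"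
    using summable_mult_fourier[OF g, of n] fourier_coeff_bound[OF g]
    by (intro infsum_mono summable_on_cmult_left summ)
       (auto simp: norm_mult circle_powi z intro!: mult_left_mono)
  also have "\<dots> = (\<Sum>\<^sub>\<infinity>k. norm (a n k)) * L1_norm g"
    by (rule infsum_cmult_left) (use summ in auto)
  finally show ?thesis .
qed

text \<open>Both sides expand to the sum of
  \<open>a n k * \<phi> (\<lambda>z. z powi k) * fourier_coeff f k\<close>. Stating it for an
  arbitrary functional covers measures and L1 densities at once.\<close>

lemma mult_op_adjoint:
  assumes \<phi>: "CT_dual \<phi>" and f: "continuous_on circle f"
  shows "pair_L1 f (mult_series a n (\<lambda>k. \<phi> (\<lambda>z. z powi k))) = \<phi> (mult_op a n f)"
proof -
  obtain C where C: "C > 0" "\<And>f B. continuous_on circle f \<Longrightarrow>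
    (\<And>z. z \<in> circle \<Longrightarrow> norm (f z) \<le> B) \<Longrightarrow> norm (\<phi> f) \<le> C * B"
    using CT_dual_bounded[OF \<phi>] by blast
  have "norm (\<phi> (\<lambda>z. z powi k)) \<le> C * 1" for k
    by (rule C(2)[OF continuous_on_circle_powi]) (simp add: circle_powi)
  note 1 = summable_mult_bounded[OF summ this]
  have "pair_L1 f (mult_series a n (\<lambda>k. \<phi> (\<lambda>z. z powi k))) =
      (\<Sum>\<^sub>\<infinity>k. a n k * \<phi> (\<lambda>z. z powi k) * fourier_coeff f k)"
    unfolding mult_series_def[abs_def]
    using CT_dual_powi_series[OF CT_dual_pair_L1_right[OF f] 1] by (simp add: pair_L1_powi_right[OF f])
  also have "\<dots> = \<phi> (mult_op a n f)"
    unfolding mult_series_def[abs_def]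
    using CT_dual_powi_series[OF \<phi> summable_mult_fourier[OF continuous_imp_L1_T[OF f]]]
    by (simp add: mult_ac)
  finally show ?thesis .
qed

lemma mult_op_adjoint_L1:
  "L1_T g \<Longrightarrow> continuous_on circle f \<Longrightarrow> pair_L1 f (mult_op a n g) = pair_L1 (mult_op a n f) g"
  using mult_op_adjoint[OF CT_dual_pair_L1_left] by (simp flip: fourier_coeff_eq_pair)

lemma mult_op_adjoint_meas:
  "cmeasure_T \<mu> \<Longrightarrow> continuous_on circle f \<Longrightarrow>
    pair_L1 f (mult_series a n (meas_coeff \<mu>)) = pair_meas (mult_op a n f) \<mu>"
  using mult_op_adjoint[OF CT_dual_pair_meas] by (simp add: meas_coeff_eq_pair)

section \<open>Uniform bounds and norm convergence of the multiplier operators\<close>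

lemma mult_op_uniformly_bounded:
  assumes pointwise: "\<And>f. continuous_on circle f \<Longrightarrow> \<exists>M. \<forall>n. norm (mult_op a n f 1) \<le> M"
  obtains C where "C \<ge> 0" "\<And>n f B z. continuous_on circle f \<Longrightarrow>
    (\<And>z. z \<in> circle \<Longrightarrow> norm (f z) \<le> B) \<Longrightarrow> z \<in> circle \<Longrightarrow> norm (mult_op a n f z) \<le> C * B"
proof -
  \<comment> \<open>A seminorm, blind to values off the circle; it bounds f pointwise only for
    continuous f, where the supremum is finite.\<close>
  define N where "N f = (SUP z\<in>circle. norm (f z))" for f :: "complex \<Rightarrow> complex"
  have N_le: "N f \<le> B" if "\<And>z. z \<in> circle \<Longrightarrow> norm (f z) \<le> B" for f B
    unfolding N_def using that by (intro cSUP_least) (auto intro: one_in_circle)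
  have N_ge: "norm (f z) \<le> N f" if f: "continuous_on circle f" and z: "z \<in> circle" for f z
  proof -
    obtain B where "\<And>z. z \<in> circle \<Longrightarrow> norm (f z) \<le> B"
      using continuous_on_circle_bounded[OF f] by blast
    then show ?thesis unfolding N_def using z by (intro cSUP_upper bdd_aboveI2[where M = B])
  qed
  have N_nonneg: "0 \<le> N f" if "continuous_on circle f" for f :: "complex \<Rightarrow> complex"
    using N_ge[OF that one_in_circle] norm_ge_zero order_trans by blast
  have "\<exists>C\<ge>0. \<forall>n. \<forall>f\<in>{f. continuous_on circle f}. norm (mult_op a n f 1) \<le> C * N f"
  proof (rule uniform_boundedness[where B = "\<lambda>n. \<Sum>\<^sub>\<infinity>k. norm (a n k)"])
    fix f :: "complex \<Rightarrow> complex" and c assume "f \<in> {f. continuous_on circle f}"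
    then have f: "continuous_on circle f" by simp
    show "N (\<lambda>z. c * f z) = norm c * N f"
    proof (rule antisym)
      show "N (\<lambda>z. c * f z) \<le> norm c * N f"
        using N_ge[OF f] by (intro N_le) (auto simp: norm_mult intro!: mult_left_mono)
      show "norm c * N f \<le> N (\<lambda>z. c * f z)"
      proof (cases "c = 0")
        case True
        then show ?thesis using N_nonneg[of "\<lambda>_. 0"] by simp
      next
        case False
        have "N f \<le> N (\<lambda>z. c * f z) / norm c"
        proof (rule N_le)
          fix z assume "z \<in> circle"
          then have "norm (c * f z) \<le> N (\<lambda>z. c * f z)"
            by (intro N_ge) (auto intro!: continuous_intros f)
          then show "norm (f z) \<le> N (\<lambda>z. c * f z) / norm c"
            using False by (simp add: norm_mult field_simps)
        qed
        then show ?thesis using False by (simp add: field_simps)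
      qed
    qed
  next
    fix n and f :: "complex \<Rightarrow> complex" assume "f \<in> {f. continuous_on circle f}"
    then have f: "continuous_on circle f" by simp
    have "(\<Sum>\<^sub>\<infinity>k. norm (a n k)) * L1_norm f \<le> (\<Sum>\<^sub>\<infinity>k. norm (a n k)) * N f"
      by (intro mult_left_mono infsum_nonneg L1_norm_le_sup continuous_imp_L1_T f N_ge) auto
    then show "norm (mult_op a n f 1) \<le> (\<Sum>\<^sub>\<infinity>k. norm (a n k)) * N f"
      using mult_op_eval_bound[OF continuous_imp_L1_T[OF f] one_in_circle, of n] by linarith
  next
    fix \<xi> :: "nat \<Rightarrow> complex \<Rightarrow> complex"
    assume "\<And>j. \<xi> j \<in> {f. continuous_on circle f} \<and> N (\<xi> j) \<le> (1/3)^j"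
    then have \<xi>: "continuous_on circle (\<xi> j)" "N (\<xi> j) \<le> (1/3)^j" for j by auto
    have le: "norm (\<xi> j z) \<le> (1/3)^j" if "z \<in> circle" for j z
      using N_ge[OF \<xi>(1) that] \<xi>(2) order_trans by blast
    have geo: "summable (\<lambda>j. (1/3::real)^j)" by (rule summable_geometric) simp
    define x where "x z = (\<Sum>j. \<xi> j z)" for z
    have lim: "uniform_limit circle (\<lambda>n z. \<Sum>j<n. \<xi> j z) x sequentially"
      unfolding x_def by (rule Weierstrass_m_test[OF le geo])
    have x: "continuous_on circle x"
      by (rule uniform_limit_theorem[OF _ lim]) (intro always_eventually allI continuous_intros \<xi>, simp)
    have "N (\<lambda>z. x z - (\<Sum>j<m. \<xi> j z)) \<le> (1/3)^m * (3/2)" for m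
    proof (rule N_le)
      fix z assume z: "z \<in> circle"
      have sum: "summable (\<lambda>j. \<xi> j z)"
        by (rule summable_comparison_test'[OF geo]) (use le z in auto)
      have "x z - (\<Sum>j<m. \<xi> j z) = (\<Sum>j. \<xi> (j + m) z)"
        unfolding x_def using suminf_minus_initial_segment[OF sum] by simp
      also have "norm \<dots> \<le> (\<Sum>j. (1/3)^m * (1/3)^j)"
      proof (rule norm_suminf_le)
        show "norm (\<xi> (j + m) z) \<le> (1/3)^m * (1/3)^j" for j
          using le[OF z, of "j + m"] by (simp only: power_add mult.commute)
        show "summable (\<lambda>j. (1/3::real)^m * (1/3)^j)" by (rule summable_mult[OF geo])
      qed
      also have "\<dots> = (1/3)^m * (3/2)"
        by (subst suminf_mult[OF geo]) (simp add: suminf_geometric)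
      finally show "norm (x z - (\<Sum>j<m. \<xi> j z)) \<le> (1/3)^m * (3/2)" .
    qed
    then show "\<exists>x\<in>{f. continuous_on circle f}. \<forall>m. N (\<lambda>t. x t - (\<Sum>j<m. \<xi> j t)) \<le> (1/3)^m * (3/2)"
      using x by blast
  next
    fix n and f g :: "complex \<Rightarrow> complex" and c
    assume "f \<in> {f. continuous_on circle f}" "g \<in> {f. continuous_on circle f}"
    then show "mult_op a n (\<lambda>x. f x + c * g x) 1 = mult_op a n f 1 + c * mult_op a n g 1"
      by (intro mult_op_lincomb continuous_imp_L1_T) auto
  qed (auto intro!: continuous_intros N_nonneg pointwise)
  then obtain C where C: "C \<ge> 0" "\<And>n f. continuous_on circle f \<Longrightarrow> norm (mult_op a n f 1) \<le> C * N f"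
    by auto
  show thesis
  proof (rule that[OF C(1)])
    fix n and f :: "complex \<Rightarrow> complex" and B and z :: complex
    assume f: "continuous_on circle f" "\<And>z. z \<in> circle \<Longrightarrow> norm (f z) \<le> B" and z: "z \<in> circle"
    \<comment> \<open>Rotation by z moves the evaluation point to 1 and preserves the bound
      B.\<close>
    have "norm (mult_op a n f z) = norm (mult_op a n (\<lambda>u. f (z * u)) 1)"
      by (simp add: mult_op_rotate[OF f(1) z])
    also have "\<dots> \<le> C * N (\<lambda>u. f (z * u))"
      by (intro C continuous_on_circle_rotate f z)
    also have "\<dots> \<le> C * B"
      by (intro mult_left_mono N_le C f circle_mult z)
    finally show "norm (mult_op a n f z) \<le> C * B" .
  qed
qed

lemma mult_op_uniform_limit:
  assumes C: "C \<ge> 0" "\<And>n f B z. continuous_on circle f \<Longrightarrow>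
      (\<And>z. z \<in> circle \<Longrightarrow> norm (f z) \<le> B) \<Longrightarrow> z \<in> circle \<Longrightarrow> norm (mult_op a n f z) \<le> C * B"
    and a1: "\<And>k. (\<lambda>n. a n k) \<longlonglongrightarrow> 1"
    and f: "continuous_on circle f"
  shows "uniform_limit circle (\<lambda>n. mult_op a n f) f sequentially"
proof (rule uniform_limitI)
  fix e :: real assume e: "e > 0"
  have trig: "uniform_limit circle (\<lambda>n. mult_op a n p) p sequentially" if "trig_poly p" for p
    using that
  proof induction
    case (powi k)
    have "uniform_limit circle (\<lambda>n z. a n k * z powi k) (\<lambda>z. 1 * z powi k) sequentially"
    proof (rule uniform_limitI)
      fix e :: real assume "e > 0"
      then have "\<forall>\<^sub>F n in sequentially. dist (a n k) 1 < e" using a1 tendstoD by blast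
      then show "\<forall>\<^sub>F n in sequentially. \<forall>z\<in>circle. dist (a n k * z powi k) (1 * z powi k) < e"
        unfolding dist_norm left_diff_distrib[symmetric] norm_mult
        by eventually_elim (simp add: circle_powi)
    qed
    then show ?case by (simp add: mult_op_powi)
  next
    case (add p q)
    have "uniform_limit circle (\<lambda>n z. mult_op a n p z + mult_op a n q z) (\<lambda>z. p z + q z) sequentially"
      using add.IH by (rule uniform_limit_add)
    moreover have "mult_op a n (\<lambda>z. p z + q z) z = mult_op a n p z + mult_op a n q z" if "z \<in> circle" for n z
      using mult_op_lincomb[OF _ _ that, of p q n 1] add.hyps
      by (simp add: continuous_imp_L1_T trig_poly_continuous)
    ultimately show ?case by (simp cong: uniform_limit_cong')
  next
    case (cmult p c)
    have p: "L1_T p" by (rule continuous_imp_L1_T[OF trig_poly_continuous[OF cmult.hyps]])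
    have 0: "L1_T (\<lambda>_. 0)" by (simp add: continuous_imp_L1_T)
    have "uniform_limit circle (\<lambda>n z. c * mult_op a n p z) (\<lambda>z. c * p z) sequentially"
      using cmult.IH by (intro bounded_linear_uniform_limit_intros)
    moreover have "mult_op a n (\<lambda>z. c * p z) z = c * mult_op a n p z" if "z \<in> circle" for n z
    proof -
      \<comment> \<open>Linearity is available in the form f + c * g; taking f = 0 turns it into
        homogeneity once T_n 0 = 0 is known.\<close>
      have "mult_op a n (\<lambda>_. 0) z = 0"
        using mult_op_eval_bound[OF 0 that, of n] by (simp add: L1_norm_eq)
      then show ?thesis using mult_op_lincomb[OF 0 p that, of n c] by simp
    qed
    ultimately show ?case by (simp cong: uniform_limit_cong')
  qed
  \<comment> \<open>The errors C * d for T_n (f - p) and d for p - f add up to e/2, leaving e/2 for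
    the convergence on p.\<close>
  define d where "d = e / 2 / (C + 1)"
  have d: "d > 0" using e C(1) by (simp add: d_def)
  have d2: "(C + 1) * d = e / 2"
    unfolding d_def using C(1) by (metis add_nonneg_pos less_irrefl mult.commute nonzero_divide_eq_eq zero_less_one)
  obtain p where p: "trig_poly p" "\<And>z. z \<in> circle \<Longrightarrow> norm (f z - p z) < d"
    using trig_poly_dense[OF f d] by blast
  note pc = trig_poly_continuous[OF p(1)]
  have "\<forall>\<^sub>F n in sequentially. \<forall>z\<in>circle. dist (mult_op a n p z) (p z) < e/2"
    using e by (intro uniform_limitD[OF trig[OF p(1)]]) simp
  then show "\<forall>\<^sub>F n in sequentially. \<forall>z\<in>circle. dist (mult_op a n f z) (f z) < e"
  proof eventually_elim
    case (elim n)
    show ?case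
    proof
      fix z assume z: "z \<in> circle"
      have "norm (mult_op a n (\<lambda>z. f z + (-1) * p z) z) \<le> C * d"
        by (intro C z) (use p f pc in \<open>auto intro!: continuous_intros less_imp_le\<close>)
      moreover have "mult_op a n (\<lambda>z. f z + (-1) * p z) z = mult_op a n f z + (-1) * mult_op a n p z"
        by (intro mult_op_lincomb continuous_imp_L1_T f pc z)
      ultimately have "norm (mult_op a n f z - mult_op a n p z) \<le> C * d" by simp
      moreover have "norm (mult_op a n p z - p z) < e/2" using elim z by (simp add: dist_norm)
      moreover have "norm (p z - f z) < d" using p(2)[OF z] by (simp add: norm_minus_commute)
      moreover have "norm (mult_op a n f z - f z) \<le> norm (mult_op a n f z - mult_op a n p z) +
          norm (mult_op a n p z - p z) + norm (p z - f z)"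
        using norm_triangle_ineq[of "mult_op a n f z - mult_op a n p z" "mult_op a n p z - f z"]
          norm_triangle_ineq[of "mult_op a n p z - p z" "p z - f z"] by simp
      ultimately show "dist (mult_op a n f z) (f z) < e"
        using d2 by (simp add: dist_norm algebra_simps)
    qed
  qed
qed

text \<open>T_n on L1 is the transpose of T_n on C(T), so it inherits the constant C. The dual
  description of the L1 norm is applicable because T_n g is continuous even when g is merely
  integrable.\<close>

lemma mult_op_L1_bound:
  assumes C: "C \<ge> 0" "\<And>n f B z. continuous_on circle f \<Longrightarrow>
      (\<And>z. z \<in> circle \<Longrightarrow> norm (f z) \<le> B) \<Longrightarrow> z \<in> circle \<Longrightarrow> norm (mult_op a n f z) \<le> C * B"
    and g: "L1_T g"
  shows "L1_norm (mult_op a n g) \<le> C * L1_norm g"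
proof (rule L1_norm_le_dual[OF mult_op_continuous[OF g]])
  fix f :: "complex \<Rightarrow> complex" assume f: "continuous_on circle f" "\<And>z. z \<in> circle \<Longrightarrow> norm (f z) \<le> 1"
  have "norm (pair_L1 (mult_op a n f) g) \<le> C * L1_norm g"
    using C(2)[OF f] by (intro pair_L1_bound mult_op_continuous continuous_imp_L1_T f g) simp
  then show "norm (pair_L1 f (mult_op a n g)) \<le> C * L1_norm g"
    by (simp add: mult_op_adjoint_L1[OF g f(1)])
qed

lemma mult_op_L1_limit:
  assumes C: "C \<ge> 0" "\<And>n f B z. continuous_on circle f \<Longrightarrow>
      (\<And>z. z \<in> circle \<Longrightarrow> norm (f z) \<le> B) \<Longrightarrow> z \<in> circle \<Longrightarrow> norm (mult_op a n f z) \<le> C * B"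
    and lim: "\<And>f. continuous_on circle f \<Longrightarrow> uniform_limit circle (\<lambda>n. mult_op a n f) f sequentially"
    and g: "L1_T g"
  shows "(\<lambda>n. L1_norm (\<lambda>z. mult_op a n g z - g z)) \<longlonglongrightarrow> 0"
proof (rule tendstoI)
  fix e :: real assume e: "e > 0"
  \<comment> \<open>With g = f + r, the part r costs C * d + d = e/2 and the continuous part e/3, in
    total 5/6 of e.\<close>
  define d where "d = e / 2 / (C + 1)"
  have d: "d > 0" using e C(1) by (simp add: d_def)
  have d2: "(C + 1) * d = e / 2"
    unfolding d_def using C(1) by (metis add_nonneg_pos less_irrefl mult.commute nonzero_divide_eq_eq zero_less_one)
  obtain f where f: "continuous_on circle f" and gf: "L1_norm (\<lambda>z. g z - f z) < d"
    using continuous_dense_L1[OF g d] by blast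
  note fL = continuous_imp_L1_T[OF f]
  define r where "r z = g z + (-1) * f z" for z
  have r: "L1_T r" unfolding r_def by (rule L1_T_lincomb[OF g fL])
  have rn: "L1_norm r < d" using gf by (simp add: r_def[abs_def])
  have "\<forall>\<^sub>F n in sequentially. \<forall>z\<in>circle. dist (mult_op a n f z) (f z) < e/3"
    using e by (intro uniform_limitD[OF lim[OF f]]) simp
  then show "\<forall>\<^sub>F n in sequentially. dist (L1_norm (\<lambda>z. mult_op a n g z - g z)) 0 < e"
  proof eventually_elim
    case (elim n)
    let ?T = "mult_op a n"
    have Tr: "L1_T (?T r)" and Tf: "L1_T (\<lambda>z. ?T f z - f z)"
      by (intro continuous_imp_L1_T mult_op_continuous r)
         (intro continuous_imp_L1_T continuous_intros mult_op_continuous fL f)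
    have "?T g z - g z = (?T r z + (?T f z - f z)) + (-1) * r z" if "z \<in> circle" for z
      using mult_op_lincomb[OF g fL that, of n "-1"] by (simp add: r_def[abs_def])
    then have "L1_norm (\<lambda>z. ?T g z - g z) = L1_norm (\<lambda>z. (?T r z + (?T f z - f z)) + (-1) * r z)"
      by (rule L1_norm_cong)
    also have "\<dots> \<le> L1_norm (\<lambda>z. ?T r z + (?T f z - f z)) + L1_norm (\<lambda>z. (-1) * r z)"
      \<comment> \<open>The instance with -2 reads r + (-2) * r = -r, the integrability of the last
        summand.\<close>
      using L1_T_lincomb[OF Tr Tf, of 1] L1_T_lincomb[OF r r, of "-2"]
      by (intro L1_norm_triangle) auto
    also have "\<dots> \<le> L1_norm (?T r) + L1_norm (\<lambda>z. ?T f z - f z) + L1_norm r"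
      using L1_norm_triangle[OF Tr Tf] L1_norm_cmult[of "-1" r] by simp
    also have "L1_norm (?T r) \<le> C * d"
      using mult_op_L1_bound[OF C r] mult_left_mono[OF less_imp_le[OF rn] C(1)] by (rule order_trans)
    also have "L1_norm (\<lambda>z. ?T f z - f z) \<le> e/3"
      using elim by (intro L1_norm_le_sup[OF Tf]) (auto simp: dist_norm intro: less_imp_le)
    finally have "L1_norm (\<lambda>z. ?T g z - g z) \<le> C * d + e/3 + L1_norm r" by simp
    also have "\<dots> < e" using rn d2 e by (simp add: algebra_simps)
    finally show ?case using L1_norm_nonneg[of "\<lambda>z. ?T g z - g z"] by simp
  qed
qed

text \<open>With f fixed, the T_n f are pointwise bounded functionals on L1 by adjointness, hence
  bounded in norm. That norm is the sup norm of T_n f, which dominates the value at 1.\<close>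

lemma mult_op_bounded_if_weak_star:
  assumes lim: "\<And>f g. L1_T g \<Longrightarrow> continuous_on circle f \<Longrightarrow>
      (\<lambda>n. pair_L1 f (mult_op a n g)) \<longlonglongrightarrow> pair_L1 f g"
    and f: "continuous_on circle f"
  shows "\<exists>M. \<forall>n. norm (mult_op a n f 1) \<le> M"
proof -
  note fL = continuous_imp_L1_T[OF f]
  have "\<exists>C\<ge>0. \<forall>n. \<forall>g\<in>{g. L1_T g}. norm (pair_L1 (mult_op a n f) g) \<le> C * L1_norm g"
  proof (rule uniform_boundedness[where B = "\<lambda>n. (\<Sum>\<^sub>\<infinity>k. norm (a n k)) * L1_norm f"])
    show "(\<lambda>_. 0) \<in> {g. L1_T g}" by (simp add: continuous_imp_L1_T)
    show "\<exists>M. \<forall>n. norm (pair_L1 (mult_op a n f) g) \<le> M" if "g \<in> {g. L1_T g}" for g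
    proof -
      have "Bseq (\<lambda>n. pair_L1 (mult_op a n f) g)"
        using lim[of g f] that f
        by (intro convergent_imp_Bseq convergentI) (auto simp: mult_op_adjoint_L1)
      then show ?thesis by (auto simp: Bseq_def)
    qed
    fix \<xi> :: "nat \<Rightarrow> complex \<Rightarrow> complex"
    assume "\<And>j. \<xi> j \<in> {g. L1_T g} \<and> L1_norm (\<xi> j) \<le> (1/3)^j"
    then show "\<exists>x\<in>{g. L1_T g}. \<forall>m. L1_norm (\<lambda>t. x t - (\<Sum>j<m. \<xi> j t)) \<le> (1/3)^m * (3/2)"
      using L1_complete[of \<xi>] by auto
  qed (auto intro: L1_T_lincomb L1_norm_nonneg L1_norm_cmult
      pair_L1_bound[OF mult_op_continuous[OF fL] _ mult_op_eval_bound[OF fL]]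
      pair_L1_add_right[OF mult_op_continuous[OF fL]])
  then obtain C where "C \<ge> 0" "\<And>n g. L1_T g \<Longrightarrow> norm (pair_L1 (mult_op a n f) g) \<le> C * L1_norm g"
    by auto
  then have "norm (mult_op a n f 1) \<le> C" for n
    by (intro pair_L1_bound_imp_sup_bound[OF mult_op_continuous[OF fL]]) (auto intro: continuous_imp_L1_T)
  then show ?thesis by blast
qed

end

section \<open>Equivalence of the five modes of convergence\<close>

theorem theorem4p1:
  fixes a :: "nat \<Rightarrow> int \<Rightarrow> complex"
  assumes summ: "\<And>n. (\<lambda>k. norm (a n k)) summable_on UNIV"
  defines "P1 \<equiv> (\<forall>f. continuous_on circle f \<longrightarrow> (\<forall>\<phi>. CT_dual \<phi> \<longrightarrow>
                    (\<lambda>n. \<phi> (mult_series a n (fourier_coeff f))) \<longlonglongrightarrow> \<phi> f))"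
      and "P2 \<equiv> (\<forall>f. continuous_on circle f \<longrightarrow>
                    uniform_limit circle (\<lambda>n. mult_series a n (fourier_coeff f)) f sequentially)"
      and "P3 \<equiv> (\<forall>\<mu>. cmeasure_T \<mu> \<longrightarrow> (\<forall>f. continuous_on circle f \<longrightarrow>
                    (\<lambda>n. pair_L1 f (mult_series a n (meas_coeff \<mu>))) \<longlonglongrightarrow> pair_meas f \<mu>))"
      and "P4 \<equiv> (\<forall>g. L1_T g \<longrightarrow> (\<forall>f. continuous_on circle f \<longrightarrow>
                    (\<lambda>n. pair_L1 f (mult_series a n (fourier_coeff g))) \<longlonglongrightarrow> pair_L1 f g))"
      and "P5 \<equiv> (\<forall>g. L1_T g \<longrightarrow>
                    (\<lambda>n. L1_norm (\<lambda>z. mult_series a n (fourier_coeff g) z - g z)) \<longlonglongrightarrow> 0)"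
  shows "(P1 \<longleftrightarrow> P2) \<and> (P2 \<longleftrightarrow> P3) \<and> (P3 \<longleftrightarrow> P4) \<and> (P4 \<longleftrightarrow> P5)"
proof -
  \<comment> \<open>Two intermediate hubs: (i) and (iii) yield \<open>R\<close>, convergence at the
    point 1, whereas (iv) leads straight to the weaker \<open>Q\<close>, which is enough for (ii)
    and (v).\<close>
  define R where "R \<longleftrightarrow> (\<forall>f. continuous_on circle f \<longrightarrow> (\<lambda>n. mult_op a n f 1) \<longlonglongrightarrow> f 1)"
  define Q where "Q \<longleftrightarrow> (\<forall>f. continuous_on circle f \<longrightarrow> (\<exists>M. \<forall>n. norm (mult_op a n f 1) \<le> M)) \<and>
    (\<forall>k. (\<lambda>n. a n k) \<longlonglongrightarrow> 1)"
  have 21: P1 if P2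
    unfolding P1_def
  proof (intro allI impI)
    fix f :: "complex \<Rightarrow> complex" and \<phi> assume f: "continuous_on circle f" and \<phi>: "CT_dual \<phi>"
    show "(\<lambda>n. \<phi> (mult_op a n f)) \<longlonglongrightarrow> \<phi> f"
      using that f unfolding P2_def
      by (intro CT_dual_tendsto[OF \<phi> mult_op_continuous[OF summ continuous_imp_L1_T[OF f]] f]) auto
  qed
  have 1: R if P1
    using that CT_dual_eval[OF one_in_circle] unfolding P1_def R_def by blast
  have RQ: Q if R
    unfolding Q_def
  proof (intro conjI allI impI)
    fix f :: "complex \<Rightarrow> complex" assume "continuous_on circle f"
    then have "Bseq (\<lambda>n. mult_op a n f 1)"
      using that unfolding R_def by (intro convergent_imp_Bseq convergentI) auto
    then show "\<exists>M. \<forall>n. norm (mult_op a n f 1) \<le> M" by (auto simp: Bseq_def)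
  next
    fix k
    have "(\<lambda>n. mult_op a n (\<lambda>z. z powi k) 1) \<longlonglongrightarrow> 1 powi k"
      using that continuous_on_circle_powi unfolding R_def by blast
    then show "(\<lambda>n. a n k) \<longlonglongrightarrow> 1" by (simp add: mult_op_powi)
  qed
  have Q25: "P2 \<and> P5" if Q
  proof -
    from that have ptw: "\<And>f. continuous_on circle f \<Longrightarrow> \<exists>M. \<forall>n. norm (mult_op a n f 1) \<le> M"
      and a1: "\<And>k. (\<lambda>n. a n k) \<longlonglongrightarrow> 1"
      unfolding Q_def by auto
    show ?thesis
    proof (rule mult_op_uniformly_bounded[OF summ ptw])
      fix C :: real
      assume C: "C \<ge> 0" "\<And>n f B z. continuous_on circle f \<Longrightarrow>
        (\<And>z. z \<in> circle \<Longrightarrow> norm (f z) \<le> B) \<Longrightarrow> z \<in> circle \<Longrightarrow> norm (mult_op a n f z) \<le> C * B"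
      note lim = mult_op_uniform_limit[OF summ C a1]
      have P2 unfolding P2_def using lim by blast
      moreover have P5 unfolding P5_def using mult_op_L1_limit[OF summ C lim] by blast
      ultimately show ?thesis ..
    qed
  qed
  have 23: P3 if P2
    unfolding P3_def
  proof (intro allI impI)
    fix \<mu> and f :: "complex \<Rightarrow> complex" assume \<mu>: "cmeasure_T \<mu>" and f: "continuous_on circle f"
    have "(\<lambda>n. pair_meas (mult_op a n f) \<mu>) \<longlonglongrightarrow> pair_meas f \<mu>"
      using 21[OF that] CT_dual_pair_meas[OF \<mu>] f unfolding P1_def by blast
    then show "(\<lambda>n. pair_L1 f (mult_series a n (meas_coeff \<mu>))) \<longlonglongrightarrow> pair_meas f \<mu>"
      by (simp add: mult_op_adjoint_meas[OF summ \<mu> f])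
  qed
  have 3: R if P3
    unfolding R_def
  proof (intro allI impI)
    fix f :: "complex \<Rightarrow> complex" assume f: "continuous_on circle f"
    obtain \<mu> where \<mu>: "cmeasure_T \<mu>" "\<And>f. continuous_on circle f \<Longrightarrow> pair_meas f \<mu> = f 1"
      using dirac_cmeasure by blast
    have "(\<lambda>n. pair_L1 f (mult_series a n (meas_coeff \<mu>))) \<longlonglongrightarrow> pair_meas f \<mu>"
      using that \<mu>(1) f unfolding P3_def by blast
    then show "(\<lambda>n. mult_op a n f 1) \<longlonglongrightarrow> f 1"
      by (simp add: mult_op_adjoint_meas[OF summ \<mu>(1) f] \<mu>(2) f
          mult_op_continuous[OF summ continuous_imp_L1_T[OF f]])
  qed
  have 24: P4 if P2
    unfolding P4_def
  proof (intro allI impI)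
    fix g f :: "complex \<Rightarrow> complex" assume g: "L1_T g" and f: "continuous_on circle f"
    have "(\<lambda>n. pair_L1 (mult_op a n f) g) \<longlonglongrightarrow> pair_L1 f g"
      using 21[OF that] CT_dual_pair_L1_left[OF g] f unfolding P1_def by blast
    then show "(\<lambda>n. pair_L1 f (mult_op a n g)) \<longlonglongrightarrow> pair_L1 f g"
      by (simp add: mult_op_adjoint_L1[OF summ g f])
  qed
  have 4: Q if P4
    unfolding Q_def
  proof (intro conjI allI impI)
    fix f :: "complex \<Rightarrow> complex" assume "continuous_on circle f"
    then show "\<exists>M. \<forall>n. norm (mult_op a n f 1) \<le> M"
      using that unfolding P4_def by (intro mult_op_bounded_if_weak_star[OF summ]) auto
  next
    fix k
    let ?e = "\<lambda>z::complex. z powi k"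
    note e = continuous_on_circle_powi[of k]
    \<comment> \<open>The character is an eigenvector of T_n and pairs with itself to 1, so weak*
      convergence on it is convergence of the eigenvalue.\<close>
    have "pair_L1 ?e (mult_op a n ?e) = a n k" for n
      using CT_dual_cmult[OF CT_dual_pair_L1_right[OF e] e, of "a n k"]
      by (simp add: mult_op_powi[abs_def] mult_op_powi fourier_coeff_powi flip: fourier_coeff_eq_pair)
    moreover have "pair_L1 ?e ?e = 1"
      by (simp add: fourier_coeff_powi flip: fourier_coeff_eq_pair)
    moreover have "(\<lambda>n. pair_L1 ?e (mult_op a n ?e)) \<longlonglongrightarrow> pair_L1 ?e ?e"
      using that continuous_imp_L1_T[OF e] e unfolding P4_def by blast
    ultimately show "(\<lambda>n. a n k) \<longlonglongrightarrow> 1" by simp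
  qed
  \<comment> \<open>Hoelder's inequality with the sup norm of f; (v) rejoins the other statements
    through (iv).\<close>
  have 54: P4 if P5
    unfolding P4_def
  proof (intro allI impI)
    fix g f :: "complex \<Rightarrow> complex" assume g: "L1_T g" and f: "continuous_on circle f"
    obtain B where B: "B \<ge> 0" "\<And>z. z \<in> circle \<Longrightarrow> norm (f z) \<le> B"
      using continuous_on_circle_bounded[OF f] by blast
    have Tg: "L1_T (mult_op a n g)" for n
      by (intro continuous_imp_L1_T mult_op_continuous[OF summ] g)
    show "(\<lambda>n. pair_L1 f (mult_op a n g)) \<longlonglongrightarrow> pair_L1 f g"
    proof (rule Lim_transform2[OF tendsto_const], rule Lim_null_comparison)
      show "\<forall>\<^sub>F n in sequentially. norm (pair_L1 f g - pair_L1 f (mult_op a n g)) \<le>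
          B * L1_norm (\<lambda>z. mult_op a n g z - g z)"
      proof (rule always_eventually, rule allI)
        fix n
        have "norm (pair_L1 f (\<lambda>z. mult_op a n g z + (-1) * g z)) \<le>
            B * L1_norm (\<lambda>z. mult_op a n g z + (-1) * g z)"
          by (rule pair_L1_bound[OF f L1_T_lincomb[OF Tg g] B(2)])
        then show "norm (pair_L1 f g - pair_L1 f (mult_op a n g)) \<le>
            B * L1_norm (\<lambda>z. mult_op a n g z - g z)"
          unfolding pair_L1_add_right[OF f Tg g] by (simp add: norm_minus_commute)
      qed
      show "(\<lambda>n. B * L1_norm (\<lambda>z. mult_op a n g z - g z)) \<longlonglongrightarrow> 0"
        using that g unfolding P5_def by (intro tendsto_mult_right_zero) auto
    qed
  qed
  \<comment> \<open>Each statement implies \<open>Q\<close>, \<open>Q\<close> gives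
    \<open>P2\<close> and \<open>P5\<close>, and \<open>P2\<close> gives the remaining
    three.\<close>
  show ?thesis
    using 21 1 RQ Q25 23 3 24 4 54 by blast
qed

end
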